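(* Let $n>1$ be an integer. Let $Sh_{2n}$ be the set of all shadows with $2n$ double points that are connected, prime and without loops, taken up to isotopy on the sphere and up to mirror image. Let $P\subset S^2$ be a prime, connected triple-crossing projection with $n$ triple points which is the projection of a minimal triple-crossing diagram of a prime knot or of a prime nonsplit link. Then, up to isotopy on the sphere and mirror image, $P$ is obtained as follows: there exist a shadow $S\in Sh_{2n}$ and a set $E$ of $n$ edges of $S$, no two of which share a vertex, such that performing the contraction operation on every edge of $E$ transforms $S$ into $P$.
   Context: All links are classical (tame) links in $3$-space, and projections lie on the sphere $S^2$. A projection of a link is a generic image with finitely many self-intersections (multiple points), at each of which the strands are pairwise transverse. It is a triple-crossing projection if every multiple point has multiplicity exactly three. A triple-crossing diagram is a triple-crossing projection in which, at each triple point, the three strands are labelled $T$, $M$, $B$ (top, middle, bottom); it represents the link in which, near each triple point, the strand $T$ lies above $M$ and $M$ lies above $B$. The triple-crossing number $c_3(L)$ is the least number of triple points of any triple-crossing diagram of $L$, and a triple-crossing diagram of $L$ is minimal if it has exactly $c_3(L)$ triple points. A shadow is a classical projection, i.e. one in which every multiple point is a double point. Shadows and triple-crossing projections are regarded as graphs embedded in $S^2$, 4-valent and 6-valent respectively, whose vertices are the multiple points; multiple edges are allowed. At each vertex the strands pass through opposite half-edges: half-edges $i$ and $i+2$ in the cyclic order at a 4-valent vertex, and half-edges $i$ and $i+3$ at a 6-valent vertex. A projection is prime if it is not a connected sum of two projections: every circle in $S^2$ that meets it transversely in exactly two points, neither of them a multiple point, bounds a disc meeting the projection in a single embedded arc without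 multiple points. A loop is an edge with both endpoints at the same vertex; "without loops" means that there are no such edges. Contraction operation: given an edge $e$ of a shadow joining two distinct 4-valent vertices $u,v$, contract $e$ to a point within the sphere, so that $u$ and $v$ merge into one 6-valent vertex. The cyclic order of its six half-edges is the three remaining half-edges at $u$ followed by the three remaining half-edges at $v$, as induced by the embedding. The resulting vertex is regarded as a triple point whose three strands join opposite half-edges. (If another edge joins $u$ to $v$, it becomes a loop at the new vertex.) *)

theory Defs
  imports "HOL-Analysis.Analysis" "HOL-Combinatorics.Orbits"
begin

section \<open>Graphs embedded in the sphere\<close>

text \<open>
  A connected graph embedded in the sphere, with multiple edges and loops allowed, is given up to
  orientation-preserving homeomorphism (equivalently, isotopy) of the sphere by its half-edges
  ("darts"), the permutation \<open>rot\<close> taking a dart to the next one counterclockwise around its vertex,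
  and the involution \<open>opp\<close> exchanging the two halves of an edge.  A dart is thought of as
  directed away from the vertex it belongs to.
\<close>

record 'a cmap =
  darts :: "'a set"
  rot :: "'a \<Rightarrow> 'a"
  opp :: "'a \<Rightarrow> 'a"

definition combinatorial_map :: "'a cmap \<Rightarrow> bool" where
  "combinatorial_map M \<longleftrightarrow>
     finite (darts M) \<and> rot M permutes darts M \<and> opp M permutes darts M \<and>
     (\<forall>d\<in>darts M. opp M d \<noteq> d \<and> opp M (opp M d) = d)"

definition vertex :: "'a cmap \<Rightarrow> 'a \<Rightarrow> 'a set" where
  "vertex M d = orbit (rot M) d"

text \<open>
  Going along a dart and then to the next dart counterclockwise at its other end follows the
  boundary of the face on the right-hand side of the dart.
\<close>

definition face :: "'a cmap \<Rightarrow> 'a \<Rightarrow> 'a set" where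
  "face M d = orbit (rot M \<circ> opp M) d"

definition vertices :: "'a cmap \<Rightarrow> 'a set set" where
  "vertices M = vertex M ` darts M"

definition edges :: "'a cmap \<Rightarrow> 'a set set" where
  "edges M = (\<lambda>d. {d, opp M d}) ` darts M"

definition faces :: "'a cmap \<Rightarrow> 'a set set" where
  "faces M = face M ` darts M"

definition step_rel :: "'a cmap \<Rightarrow> ('a \<times> 'a) set" where
  "step_rel M = {(d, rot M d) | d. d \<in> darts M} \<union> {(d, opp M d) | d. d \<in> darts M}"

definition connected_map :: "'a cmap \<Rightarrow> bool" where
  "connected_map M \<longleftrightarrow> (\<forall>d\<in>darts M. \<forall>d'\<in>darts M. (d, d') \<in> (step_rel M)\<^sup>*)"

text \<open>
  A nonempty connected graph with its rotation system, embedded cellularly in its closed oriented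
  surface, lies on the sphere iff its Euler characteristic is two.
\<close>

definition connected_sphere_map :: "'a cmap \<Rightarrow> bool" where
  "connected_sphere_map M \<longleftrightarrow>
     combinatorial_map M \<and> connected_map M \<and> darts M \<noteq> {} \<and>
     card (vertices M) + card (faces M) = card (edges M) + 2"

definition regular_map :: "nat \<Rightarrow> 'a cmap \<Rightarrow> bool" where
  "regular_map k M \<longleftrightarrow> (\<forall>v\<in>vertices M. card v = k)"

definition loopless :: "'a cmap \<Rightarrow> bool" where
  "loopless M \<longleftrightarrow> (\<forall>d\<in>darts M. opp M d \<notin> vertex M d)"

text \<open>
  A circle on the sphere that meets the graph transversely in exactly two points, neither of them a
  vertex, crosses the edge of some dart \<open>d\<close> from its right to its left, runs through the face on
  the left, crosses the edge of a dart \<open>d'\<close> from its right to its left, and returns through a face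
  to where it started; the face on the left of a dart is the face on the right of the opposite
  dart.  Up to isotopy a circle is determined by the pair \<open>d\<close>, \<open>d'\<close>, because the
  faces of a connected graph are open discs.  If the two crossing points lie on different edges,
  each of the two discs bounded by the circle contains an end of the crossed edges.  So one of the
  discs meets the graph in a single arc without vertices iff both points lie on one edge, which is
  then crossed there and back.
\<close>

definition two_point_circle :: "'a cmap \<Rightarrow> 'a \<Rightarrow> 'a \<Rightarrow> bool" where
  "two_point_circle M d d' \<longleftrightarrow>
     d \<in> darts M \<and> d' \<in> darts M \<and>
     face M (opp M d) = face M d' \<and> face M (opp M d') = face M d"

definition prime_map :: "'a cmap \<Rightarrow> bool" where
  "prime_map M \<longleftrightarrow> (\<forall>d d'. two_point_circle M d d' \<longrightarrow> d' = opp M d)"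

definition cmap_iso :: "'a cmap \<Rightarrow> 'b cmap \<Rightarrow> bool" where
  "cmap_iso M N \<longleftrightarrow>
     (\<exists>f. bij_betw f (darts M) (darts N) \<and>
        (\<forall>d\<in>darts M. f (rot M d) = rot N (f d) \<and> f (opp M d) = opp N (f d)))"

definition mirror :: "'a cmap \<Rightarrow> 'a cmap" where
  "mirror M = M\<lparr>rot := inv (rot M)\<rparr>"

definition equiv_mirror :: "'a cmap \<Rightarrow> 'b cmap \<Rightarrow> bool" where
  "equiv_mirror M N \<longleftrightarrow> cmap_iso M N \<or> cmap_iso (mirror M) N"

text \<open>
  At a vertex with an even number of half-edges the strands join opposite half-edges, so they are
  determined by the rotation and not recorded separately.
\<close>

definition triple_crossing_map :: "'a cmap \<Rightarrow> bool" where
  "triple_crossing_map P \<longleftrightarrow> connected_sphere_map P \<and> regular_map 6 P"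

text \<open>
  Representatives of the classes of shadows under isotopy and mirror image: every finite map is
  isomorphic to one whose darts are natural numbers.
\<close>

definition Sh :: "nat \<Rightarrow> nat cmap set" where
  "Sh m = {S. connected_sphere_map S \<and> regular_map 4 S \<and> card (vertices S) = m \<and>
              prime_map S \<and> loopless S}"

definition edge_ends :: "'a cmap \<Rightarrow> 'a set \<Rightarrow> 'a set set" where
  "edge_ends M e = vertex M ` e"

definition pairwise_vertex_disjoint :: "'a cmap \<Rightarrow> 'a set set \<Rightarrow> bool" where
  "pairwise_vertex_disjoint M E \<longleftrightarrow>
     (\<forall>e\<in>E. \<forall>e'\<in>E. e \<noteq> e' \<longrightarrow> edge_ends M e \<inter> edge_ends M e' = {})"

text \<open>
  Simultaneous contraction of all edges in \<open>E\<close>, for pairwise vertex-disjoint edges that are not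
  loops.  For an edge with halves \<open>d\<close> and \<open>d'\<close>, and cyclic orders \<open>d, a1, a2, a3\<close> and
  \<open>d', b1, b2, b3\<close> at its two ends, the merged vertex has cyclic order \<open>a1, a2, a3, b1, b2, b3\<close>:
  a dart that was followed by \<open>d\<close> is now followed by the successor of \<open>d'\<close>, and vice versa.
\<close>

definition contract :: "'a cmap \<Rightarrow> 'a set set \<Rightarrow> 'a cmap" where
  "contract M E =
     \<lparr>darts = darts M - \<Union>E,
      rot = (\<lambda>x. if x \<notin> darts M - \<Union>E then x
                 else if rot M x \<in> \<Union>E then rot M (opp M (rot M x))
                 else rot M x),
      opp = (\<lambda>x. if x \<notin> darts M - \<Union>E then x else opp M x)\<rparr>"

section \<open>Links in 3-space\<close>

definition ambient_isotopic :: "(real^3) set \<Rightarrow> (real^3) set \<Rightarrow> bool" where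
  "ambient_isotopic A B \<longleftrightarrow>
     (\<exists>H :: real \<Rightarrow> real^3 \<Rightarrow> real^3.
        continuous_on ({0..1} \<times> UNIV) (\<lambda>(s, x). H s x) \<and>
        (\<forall>s\<in>{0..1}. \<exists>g. homeomorphism UNIV UNIV (H s) g) \<and>
        (\<forall>x. H 0 x = x) \<and> H 1 ` A = B)"

definition regular_closed_curve :: "(real \<Rightarrow> real^3) \<Rightarrow> bool" where
  "regular_closed_curve c \<longleftrightarrow>
     c C1_differentiable_on UNIV \<and> (\<forall>t. vector_derivative c (at t) \<noteq> 0) \<and> (\<forall>t. c (t + 1) = c t)"

definition tame_link :: "(real^3) set \<Rightarrow> bool" where
  "tame_link L \<longleftrightarrow>
     (\<exists>cs. cs \<noteq> [] \<and> (\<forall>c\<in>set cs. regular_closed_curve c) \<and>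
        (\<forall>i<length cs. \<forall>j<length cs. \<forall>s\<in>{0..<1}. \<forall>t\<in>{0..<1}.
            (cs ! i) s = (cs ! j) t \<longrightarrow> i = j \<and> s = t) \<and>
        ambient_isotopic (\<Union>c\<in>set cs. range c) L)"

definition is_knot :: "(real^3) set \<Rightarrow> bool" where
  "is_knot L \<longleftrightarrow> tame_link L \<and> connected L"

definition unknot :: "(real^3) set \<Rightarrow> bool" where
  "unknot K \<longleftrightarrow> ambient_isotopic {x. x $ 3 = 0 \<and> norm x = 1} K"

text \<open>
  Tamely embedded 2-spheres are the images \<open>h ` sphere 0 1\<close> under homeomorphisms \<open>h\<close> of 3-space;
  their two sides are \<open>h ` ball 0 1\<close> and the complement of \<open>h ` cball 0 1\<close>.
\<close>

definition split_link :: "(real^3) set \<Rightarrow> bool" where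
  "split_link L \<longleftrightarrow>
     (\<exists>(h :: real^3 \<Rightarrow> real^3) h'. homeomorphism UNIV UNIV h h' \<and> L \<inter> h ` sphere 0 1 = {} \<and>
        L \<inter> h ` ball 0 1 \<noteq> {} \<and> L - h ` cball 0 1 \<noteq> {})"

definition meets_transversely_at :: "(real^3) set \<Rightarrow> (real^3) set \<Rightarrow> real^3 \<Rightarrow> bool" where
  "meets_transversely_at L S p \<longleftrightarrow>
     (\<exists>U (f :: real^3 \<Rightarrow> real^3) f'. open U \<and> p \<in> U \<and> homeomorphism U UNIV f f' \<and>
        f ` (S \<inter> U) = {x. x $ 1 = 0} \<and> f ` (L \<inter> U) = {x. x $ 2 = 0 \<and> x $ 3 = 0})"

text \<open>
  A 2-sphere meeting a link transversely in two points exhibits it as a connected sum.  The summands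
  are obtained by closing the part of the link on either side of the sphere with an arc on the
  sphere, and the part of the link on one side is a single unknotted arc iff the corresponding
  summand is the unknot.  Formulating it by closing arcs treats the two sides alike, although only
  one of them is a ball before 3-space is compactified.
\<close>

definition prime_link :: "(real^3) set \<Rightarrow> bool" where
  "prime_link L \<longleftrightarrow>
     tame_link L \<and> \<not> unknot L \<and>
     (\<forall>(h :: real^3 \<Rightarrow> real^3) h'. homeomorphism UNIV UNIV h h' \<and> card (L \<inter> h ` sphere 0 1) = 2 \<and>
         (\<forall>p \<in> L \<inter> h ` sphere 0 1. meets_transversely_at L (h ` sphere 0 1) p) \<longrightarrow>
       (\<exists>g. arc g \<and> path_image g \<subseteq> h ` sphere 0 1 \<and>
          {pathstart g, pathfinish g} = L \<inter> h ` sphere 0 1 \<and>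
          (unknot (L \<inter> h ` cball 0 1 \<union> path_image g) \<or>
           unknot (L - h ` ball 0 1 \<union> path_image g))))"

section \<open>Projections and triple-crossing diagrams\<close>

text \<open>
  A projection is given by its component curves \<open>ps\<close>, closed curves of period one on the unit
  sphere.  A strand \<open>(i, t)\<close> is the passage of the \<open>i\<close>-th curve at parameter \<open>t\<close>.
\<close>

definition strands :: "(real \<Rightarrow> real^3) list \<Rightarrow> real^3 \<Rightarrow> (nat \<times> real) set" where
  "strands ps x = {(i, t). i < length ps \<and> t \<in> {0..<1} \<and> (ps ! i) t = x}"

definition multiple_points :: "(real \<Rightarrow> real^3) list \<Rightarrow> (real^3) set" where
  "multiple_points ps = {x. \<exists>a\<in>strands ps x. \<exists>b\<in>strands ps x. a \<noteq> b}"

definition velocity :: "(real \<Rightarrow> real^3) list \<Rightarrow> nat \<times> real \<Rightarrow> real^3" where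
  "velocity ps a = vector_derivative (ps ! fst a) (at (snd a))"

definition generic_projection :: "(real \<Rightarrow> real^3) list \<Rightarrow> bool" where
  "generic_projection ps \<longleftrightarrow>
     ps \<noteq> [] \<and> (\<forall>p\<in>set ps. regular_closed_curve p \<and> range p \<subseteq> sphere 0 1) \<and>
     finite (multiple_points ps) \<and>
     (\<forall>x\<in>multiple_points ps. \<forall>a\<in>strands ps x. \<forall>b\<in>strands ps x. a \<noteq> b \<longrightarrow>
        cross3 (velocity ps a) (velocity ps b) \<noteq> 0)"

definition triple_crossing_projection :: "(real \<Rightarrow> real^3) list \<Rightarrow> bool" where
  "triple_crossing_projection ps \<longleftrightarrow>
     generic_projection ps \<and> (\<forall>x\<in>multiple_points ps. card (strands ps x) = 3)"

datatype level = Top | Middle | Bottom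

definition triple_crossing_diagram ::
    "(real \<Rightarrow> real^3) list \<Rightarrow> (nat \<times> real \<Rightarrow> level) \<Rightarrow> bool" where
  "triple_crossing_diagram ps lab \<longleftrightarrow>
     triple_crossing_projection ps \<and> (\<forall>x\<in>multiple_points ps. inj_on lab (strands ps x))"

text \<open>
  A neighbourhood of the sphere is seen from outside: the point of the link over the point \<open>x\<close> of
  the projection lies on the ray through \<open>x\<close>, and its height is its distance from the origin.
\<close>

definition represents ::
    "(real \<Rightarrow> real^3) list \<Rightarrow> (nat \<times> real \<Rightarrow> level) \<Rightarrow> (real^3) set \<Rightarrow> bool" where
  "represents ps lab L \<longleftrightarrow>
     (\<exists>h :: nat \<Rightarrow> real \<Rightarrow> real.
        (\<forall>i<length ps. continuous_on UNIV (h i) \<and> (\<forall>t. h i t > 0 \<and> h i (t + 1) = h i t)) \<and>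
        (\<forall>x\<in>multiple_points ps. \<forall>(i, s)\<in>strands ps x. \<forall>(j, t)\<in>strands ps x.
           (lab (i, s), lab (j, t)) \<in> {(Top, Middle), (Middle, Bottom)} \<longrightarrow> h i s > h j t) \<and>
        ambient_isotopic (\<Union>i<length ps. range (\<lambda>t. h i t *\<^sub>R (ps ! i) t)) L)"

definition c3 :: "(real^3) set \<Rightarrow> nat" where
  "c3 L = (LEAST k. \<exists>ps lab. triple_crossing_diagram ps lab \<and> represents ps lab L \<and>
                      card (multiple_points ps) = k)"

definition minimal_triple_crossing_diagram ::
    "(real \<Rightarrow> real^3) list \<Rightarrow> (nat \<times> real \<Rightarrow> level) \<Rightarrow> (real^3) set \<Rightarrow> bool" where
  "minimal_triple_crossing_diagram ps lab L \<longleftrightarrow>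
     triple_crossing_diagram ps lab \<and> represents ps lab L \<and> card (multiple_points ps) = c3 L"

section \<open>The embedded graph of a projection\<close>

text \<open>
  A half-edge \<open>(a, b)\<close> of a projection leaves a multiple point along the strand \<open>a\<close>, in the
  direction of increasing parameter iff \<open>b\<close> holds.
\<close>

definition half_edges :: "(real \<Rightarrow> real^3) list \<Rightarrow> ((nat \<times> real) \<times> bool) set" where
  "half_edges ps = (\<Union>x\<in>multiple_points ps. strands ps x) \<times> UNIV"

definition base_point :: "(real \<Rightarrow> real^3) list \<Rightarrow> (nat \<times> real) \<times> bool \<Rightarrow> real^3" where
  "base_point ps d = (ps ! fst (fst d)) (snd (fst d))"

definition direction :: "(real \<Rightarrow> real^3) list \<Rightarrow> (nat \<times> real) \<times> bool \<Rightarrow> real^3" where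
  "direction ps d = (if snd d then velocity ps (fst d) else - velocity ps (fst d))"

text \<open>
  \<open>d'\<close> leaves from the same point of the sphere, at an angle between 0 and 180 degrees
  counterclockwise (seen from outside) from \<open>d\<close>.
\<close>

definition left_of ::
    "(real \<Rightarrow> real^3) list \<Rightarrow> (nat \<times> real) \<times> bool \<Rightarrow> (nat \<times> real) \<times> bool \<Rightarrow> bool" where
  "left_of ps d d' \<longleftrightarrow>
     base_point ps d' = base_point ps d \<and>
     inner (base_point ps d) (cross3 (direction ps d) (direction ps d')) > 0"

text \<open>
  At a multiple point the directions come in opposite pairs, so the next one counterclockwise
  is less than 180 degrees away.
\<close>

definition ccw_next ::
    "(real \<Rightarrow> real^3) list \<Rightarrow> (nat \<times> real) \<times> bool \<Rightarrow> (nat \<times> real) \<times> bool \<Rightarrow> bool" where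
  "ccw_next ps d d' \<longleftrightarrow>
     left_of ps d d' \<and> \<not> (\<exists>c\<in>half_edges ps. left_of ps d c \<and> left_of ps c d')"

definition traverses ::
    "(real \<Rightarrow> real^3) list \<Rightarrow> (nat \<times> real) \<times> bool \<Rightarrow> (nat \<times> real) \<times> bool \<Rightarrow> bool" where
  "traverses ps d d' \<longleftrightarrow>
     (\<exists>i s u. d = ((i, s), True) \<and> d' = ((i, frac u), False) \<and> s < u \<and>
        (\<forall>w\<in>{s<..<u}. (ps ! i) w \<notin> multiple_points ps))"

text \<open>
  \<open>P\<close> is the embedded graph formed by the projection.  Every component has to pass
  through a multiple point, as otherwise it would not be covered by the edges.
\<close>

definition has_graph :: "(real \<Rightarrow> real^3) list \<Rightarrow> 'a cmap \<Rightarrow> bool" where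
  "has_graph ps P \<longleftrightarrow>
     (\<forall>p\<in>set ps. range p \<inter> multiple_points ps \<noteq> {}) \<and>
     (\<exists>f. bij_betw f (darts P) (half_edges ps) \<and>
        (\<forall>d\<in>darts P. ccw_next ps (f d) (f (rot P d)) \<and>
           (traverses ps (f d) (f (opp P d)) \<or> traverses ps (f (opp P d)) (f d))))"

end

theory Submission
  imports Defs
begin

text \<open>
  Splitting a triple point into two double points joined by a short edge is the inverse of a
  contraction, and there are three ways to do it, one for every pair of opposite gaps between the six
  half-edges.  The shadow \<open>S\<close> is obtained by splitting all triple points of \<open>P\<close>, one after the
  other, in such a way that the projection stays prime.  That this is possible holds for every prime
  spherical graph with vertices of degrees 4 and 6 that has more than one vertex.

  Primeness is a property of the abstract graph.  A circle that meets a spherical graph in two points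
  of different edges separates the vertices, so the two edges form an edge cut; conversely two edges
  that form a cut are crossed by a circle.  As all degrees are even, all edge cuts are even.  Hence a
  connected graph is prime iff every edge cut has at least four edges, which is
  \<open>four_edge_connected_imp_prime\<close> and \<open>prime_imp_four_edge_connected\<close>.  The topological ingredient
  is a discrete Jordan curve theorem, \<open>even_dual_curve_bounds\<close>, obtained from Euler's formula by
  counting.

  Suppose that a splitting of a 6-valent vertex \<open>v\<close> destroys 4-edge-connectivity.  Then the other
  vertices fall into two classes such that at most one edge away from \<open>v\<close> joins the two classes and
  each class is attached to its own three consecutive half-edges of \<open>v\<close>.  If two different splittings
  are bad, the two partitions cross, and counting the edges that leave the four intersections gives a
  loop at \<open>v\<close> between neighbouring half-edges (\<open>uncrossing\<close>).  If all three are bad, the loops use up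
  all half-edges of \<open>v\<close>, and \<open>v\<close> is the only vertex (\<open>one_of_three_splits\<close>).  So some splitting is
  good, also in the presence of loops.

  Each splitting adds one vertex and one edge and keeps the number of faces, hence the sphere.  In the
  end all vertices are 4-valent, the new edges are disjoint because every new vertex lies on one of
  them, and contracting them restores \<open>P\<close> (\<open>split_all_six_valent\<close>).  A loop in the resulting shadow
  is impossible, because the other two edges at its vertex would form a cut.
\<close>

section \<open>Orbits and parities of finite sets\<close>

lemma orbit_self:
  assumes "f permutes A" "finite A" shows "x \<in> orbit f x"
  using assms by (intro permutation_self_in_orbit) (auto simp: permutation_permutes)

lemma orbit_eq:
  assumes "f permutes A" "finite A" "y \<in> orbit f x" shows "orbit f y = orbit f x"
  using orbit_cyclic_eq3[OF cyclic_on_orbit[OF assms(1,2)] assms(3)] .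

lemma orbit_disjoint:
  assumes "f permutes A" "finite A" "orbit f x \<noteq> orbit f y" shows "orbit f x \<inter> orbit f y = {}"
  using orbit_eq[OF assms(1,2)] assms(3) by blast

lemma dvd_card_orbit_union:
  assumes f: "f permutes A" "finite A" and X: "X \<subseteq> A" "\<And>x. x \<in> X \<Longrightarrow> f x \<in> X"
    and k: "\<And>x. x \<in> X \<Longrightarrow> k dvd card (orbit f x)"
  shows "k dvd card X"
proof -
  have sub: "orbit f x \<subseteq> X" if "x \<in> X" for x
  proof
    fix y assume "y \<in> orbit f x" then show "y \<in> X" by induction (use X that in auto)
  qed
  have "\<Union>(orbit f ` X) = X"
    using sub orbit_self[OF f] by auto
  moreover have "k dvd card (\<Union>(orbit f ` X))"
  proof (rule dvd_partition)
    show "finite (\<Union>(orbit f ` X))"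
      using \<open>\<Union>(orbit f ` X) = X\<close> X(1) f(2) finite_subset by metis
    show "\<forall>c\<in>orbit f ` X. k dvd card c" using k by auto
    show "\<forall>c1\<in>orbit f ` X. \<forall>c2\<in>orbit f ` X. c1 \<noteq> c2 \<longrightarrow> c1 \<inter> c2 = {}"
      using orbit_disjoint[OF f] by auto
  qed
  ultimately show ?thesis by simp
qed

lemma even_card_involution:
  assumes fin: "finite X" and h: "\<And>x. x \<in> X \<Longrightarrow> h x \<in> X" "\<And>x. x \<in> X \<Longrightarrow> h x \<noteq> x"
    "\<And>x. x \<in> X \<Longrightarrow> h (h x) = x"
  shows "even (card X)"
proof -
  let ?C = "(\<lambda>x. {x, h x}) ` X"
  have U: "\<Union>?C = X"
  proof
    show "\<Union>?C \<subseteq> X" by (rule UN_least) (simp add: h(1))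
    show "X \<subseteq> \<Union>?C" by blast
  qed
  have class_eq: "{z, h z} = {x, h x}" if "x \<in> X" "z \<in> {x, h x}" for x z
    using that(2) h(3)[OF that(1)] by (elim insertE) (simp_all add: insert_commute)
  have "2 dvd card (\<Union>?C)"
  proof (rule dvd_partition)
    show "finite (\<Union>?C)" using U fin by simp
    show "\<forall>c\<in>?C. 2 dvd card c"
    proof (rule ballI)
      fix c assume "c \<in> ?C"
      then obtain x where "c = {x, h x}" "x \<in> X" by blast
      then show "2 dvd card c" using h(2)[of x] by (simp add: card_insert_if)
    qed
    show "\<forall>c1\<in>?C. \<forall>c2\<in>?C. c1 \<noteq> c2 \<longrightarrow> c1 \<inter> c2 = {}"
    proof (intro ballI impI, rule ccontr)
      fix c1 c2 assume c: "c1 \<in> ?C" "c2 \<in> ?C" "c1 \<noteq> c2" "c1 \<inter> c2 \<noteq> {}"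
      from c(1) obtain x where x: "x \<in> X" "c1 = {x, h x}" by (rule imageE)
      from c(2) obtain y where y: "y \<in> X" "c2 = {y, h y}" by (rule imageE)
      from c(4) obtain z where "z \<in> c1" "z \<in> c2" by (meson disjoint_iff)
      then have z: "z \<in> {x, h x}" "z \<in> {y, h y}" unfolding x(2) y(2) .
      show False using c(3) class_eq[OF x(1) z(1)] class_eq[OF y(1) z(2)] unfolding x(2) y(2) by argo
    qed
  qed
  then show ?thesis using U by simp
qed

lemma odd_card_sym_diff:
  assumes "finite A" "finite B"
  shows "odd (card (F \<inter> sym_diff A B)) \<longleftrightarrow> odd (card (F \<inter> A)) \<noteq> odd (card (F \<inter> B))"
proof -
  let ?A = "F \<inter> A" and ?B = "F \<inter> B"
  have fin: "finite ?A" "finite ?B" using assms by auto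
  have "F \<inter> sym_diff A B = (?A - ?B) \<union> (?B - ?A)" by blast
  then have "card (F \<inter> sym_diff A B) = card (?A - ?B) + card (?B - ?A)"
    using fin card_Un_disjoint[of "?A - ?B" "?B - ?A"] by (simp add: disjoint_iff)
  moreover have "card ?A = card (?A \<inter> ?B) + card (?A - ?B)" by (rule card_Int_Diff[OF fin(1)])
  moreover have "card ?B = card (?B \<inter> ?A) + card (?B - ?A)" by (rule card_Int_Diff[OF fin(2)])
  moreover have "?B \<inter> ?A = ?A \<inter> ?B" by blast
  ultimately show ?thesis by (metis even_add)
qed

section \<open>Edge cuts\<close>

text \<open>
  A set of vertices is represented by the set of darts that leave its members.
\<close>

definition vertex_union :: "'a cmap \<Rightarrow> 'a set \<Rightarrow> bool" where
  "vertex_union M X \<longleftrightarrow> X \<subseteq> darts M \<and> (\<forall>d\<in>X. rot M d \<in> X)"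

text \<open>
  Every edge between \<open>X\<close> and its complement has exactly one of its darts in this set, so its
  cardinality is the size of the edge cut.  It is used also for sets \<open>X\<close> that contain only some of
  the darts at a vertex, as they arise from cuts of a graph in which that vertex has been split.
\<close>

definition out_darts :: "'a cmap \<Rightarrow> 'a set \<Rightarrow> 'a set" where
  "out_darts M X = {d\<in>X. opp M d \<notin> X}"

text \<open>
  A cut of size zero is a disconnection, and the cuts of size two are the decompositions as a
  connected sum.  Cuts of odd size do not occur in graphs with even degrees.
\<close>

definition four_edge_connected :: "'a cmap \<Rightarrow> bool" where
  "four_edge_connected M \<longleftrightarrow>
     (\<forall>X. vertex_union M X \<and> X \<noteq> {} \<and> X \<noteq> darts M \<longrightarrow> 4 \<le> card (out_darts M X))"

lemma four_edge_connectedD: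
  assumes "four_edge_connected M" "vertex_union M X" "card (out_darts M X) < 4"
  shows "X = {} \<or> X = darts M"
  using assms unfolding four_edge_connected_def by force

context
  fixes M :: "'a cmap"
  assumes M: "combinatorial_map M"
begin

lemma finite_darts: "finite (darts M)"
  and rot_permutes: "rot M permutes darts M"
  and opp_permutes: "opp M permutes darts M"
  and opp_neq: "d \<in> darts M \<Longrightarrow> opp M d \<noteq> d"
  and opp_opp: "d \<in> darts M \<Longrightarrow> opp M (opp M d) = d"
  using M unfolding combinatorial_map_def by auto

lemma rot_in_iff: "rot M d \<in> darts M \<longleftrightarrow> d \<in> darts M"
  and opp_in_iff: "opp M d \<in> darts M \<longleftrightarrow> d \<in> darts M"
  by (rule permutes_in_image[OF rot_permutes] permutes_in_image[OF opp_permutes])+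

lemma face_permutes: "(rot M \<circ> opp M) permutes darts M"
  by (rule permutes_compose[OF opp_permutes rot_permutes])

lemmas in_vertex = orbit_self[OF rot_permutes finite_darts, folded vertex_def]
lemmas vertex_eq = orbit_eq[OF rot_permutes finite_darts, folded vertex_def]
lemmas in_face = orbit_self[OF face_permutes finite_darts, folded face_def]
lemmas face_eq = orbit_eq[OF face_permutes finite_darts, folded face_def]

lemma vertex_subset: "d \<in> darts M \<Longrightarrow> vertex M d \<subseteq> darts M"
  unfolding vertex_def by (rule permutes_orbit_subset[OF rot_permutes])

lemma face_subset: "d \<in> darts M \<Longrightarrow> face M d \<subseteq> darts M"
  unfolding face_def by (rule permutes_orbit_subset[OF face_permutes])

lemma edges_subset: "e \<in> edges M \<Longrightarrow> e \<subseteq> darts M"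
  using opp_in_iff by (auto simp: edges_def)

lemma vertex_union_vertex: "d \<in> darts M \<Longrightarrow> vertex_union M (vertex M d)"
  unfolding vertex_union_def using vertex_subset by (auto simp: vertex_def orbit.step)

lemma vertex_union_rot_iff:
  assumes "vertex_union M X" shows "rot M d \<in> X \<longleftrightarrow> d \<in> X"
proof
  assume r: "rot M d \<in> X"
  have "rot M ` X = X"
    using assms finite_darts permutes_inj_on[OF rot_permutes]
    by (intro endo_inj_surj) (auto simp: vertex_union_def intro: finite_subset)
  with r obtain d' where "d' \<in> X" "rot M d' = rot M d" by (metis imageE)
  then show "d \<in> X" using permutes_inj[OF rot_permutes] by (auto dest: injD)
qed (use assms in \<open>auto simp: vertex_union_def\<close>)

lemma vertex_union_diff:
  "vertex_union M X \<Longrightarrow> vertex_union M Y \<Longrightarrow> vertex_union M (X - Y)"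
  unfolding vertex_union_def using vertex_union_rot_iff[of Y] by (auto simp: vertex_union_def)

lemma vertex_union_darts: "vertex_union M (darts M)"
  by (auto simp: vertex_union_def rot_in_iff)

lemma finite_out_darts: "X \<subseteq> darts M \<Longrightarrow> finite (out_darts M X)"
  by (rule finite_subset[OF _ finite_darts]) (auto simp: out_darts_def)

lemma out_darts_complement:
  assumes "X \<subseteq> darts M"
  shows "out_darts M (darts M - X) = opp M ` out_darts M X"
proof
  show "out_darts M (darts M - X) \<subseteq> opp M ` out_darts M X"
  proof
    fix d assume "d \<in> out_darts M (darts M - X)"
    then have "d = opp M (opp M d)" "opp M d \<in> out_darts M X"
      using opp_opp[of d] by (auto simp: out_darts_def opp_in_iff)
    then show "d \<in> opp M ` out_darts M X" by (rule image_eqI)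
  qed
  show "opp M ` out_darts M X \<subseteq> out_darts M (darts M - X)"
    using assms opp_opp by (auto simp: out_darts_def opp_in_iff)
qed

lemma card_out_darts_complement:
  assumes "X \<subseteq> darts M"
  shows "card (out_darts M (darts M - X)) = card (out_darts M X)"
  unfolding out_darts_complement[OF assms]
  by (rule card_image) (rule permutes_inj_on[OF opp_permutes])

text \<open>
  The handshake argument: the darts at the vertices in \<open>X\<close> are even in number, and those whose edge
  stays in \<open>X\<close> come in pairs.
\<close>

lemma even_out_darts:
  assumes even: "\<And>v. v \<in> vertices M \<Longrightarrow> even (card v)" and X: "vertex_union M X"
  shows "even (card (out_darts M X))"
proof -
  have XM: "X \<subseteq> darts M" and fin: "finite X"
    using X finite_darts finite_subset by (auto simp: vertex_union_def)
  have "even (card X)"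
  proof (rule dvd_card_orbit_union[OF rot_permutes finite_darts XM])
    show "rot M x \<in> X" if "x \<in> X" for x using X that by (auto simp: vertex_union_def)
    show "even (card (orbit (rot M) x))" if "x \<in> X" for x
      using even[of "vertex M x"] that XM by (auto simp: vertex_def vertices_def)
  qed
  moreover have "even (card {d\<in>X. opp M d \<in> X})"
  proof (rule even_card_involution[where h = "opp M"])
    show "finite {d\<in>X. opp M d \<in> X}" using fin by simp
    show "opp M x \<in> {d\<in>X. opp M d \<in> X}" "opp M x \<noteq> x" "opp M (opp M x) = x"
      if "x \<in> {d\<in>X. opp M d \<in> X}" for x
      using that XM opp_neq[of x] opp_opp[of x] by auto
  qed
  moreover have "card X = card {d\<in>X. opp M d \<in> X} + card (out_darts M X)"
  proof -
    have "{d\<in>X. opp M d \<in> X} \<inter> out_darts M X = {}" "X = {d\<in>X. opp M d \<in> X} \<union> out_darts M X"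
      by (auto simp: out_darts_def)
    then show ?thesis using fin card_Un_disjoint by (metis finite_Un)
  qed
  ultimately show ?thesis by (metis even_add)
qed

end

section \<open>A discrete Jordan curve theorem\<close>


definition coboundary :: "'a cmap \<Rightarrow> 'a set \<Rightarrow> 'a set" where
  "coboundary M X = {d\<in>darts M. d \<in> X \<longleftrightarrow> opp M d \<notin> X}"

lemma card_coboundary:
  assumes M: "combinatorial_map M" and X: "X \<subseteq> darts M"
  shows "card (coboundary M X) = 2 * card (out_darts M X)"
proof -
  have "coboundary M X = out_darts M X \<union> out_darts M (darts M - X)"
    using X opp_in_iff[OF M] by (auto simp: coboundary_def out_darts_def)
  moreover have "out_darts M X \<inter> out_darts M (darts M - X) = {}"
    by (auto simp: out_darts_def)
  ultimately show ?thesis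
    using card_out_darts_complement[OF M X] finite_out_darts[OF M X]
      finite_out_darts[OF M, of "darts M - X"] by (simp add: card_Un_disjoint)
qed

text \<open>
  Walking once around a face, one changes sides between \<open>X\<close> and its complement an even number of
  times, because \<open>opp M d\<close> and the next dart \<open>rot M (opp M d)\<close> belong to the same vertex.
\<close>

lemma even_face_coboundary:
  assumes M: "combinatorial_map M" and X: "vertex_union M X" and d: "d \<in> darts M"
  shows "even (card (face M d \<inter> coboundary M X))"
proof -
  let ?F = "face M d" and ?phi = "rot M \<circ> opp M"
  have fin: "finite ?F" using face_subset[OF M d] finite_darts[OF M] finite_subset by blast
  have eq: "?F \<inter> coboundary M X = ?F \<inter> sym_diff X {x \<in> ?F. ?phi x \<in> X}"
    using face_subset[OF M d] by (auto simp: coboundary_def vertex_union_rot_iff[OF M X])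
  have "?phi ` ?F = ?F"
    using permutes_inj_on[OF face_permutes[OF M]] fin
    by (intro endo_inj_surj) (auto simp: face_def intro: orbit_eqI)
  then have "?phi ` {x \<in> ?F. ?phi x \<in> X} = ?F \<inter> X" by auto
  then have "card {x \<in> ?F. ?phi x \<in> X} = card (?F \<inter> X)"
    using card_image[OF permutes_inj_on[OF face_permutes[OF M]]] by metis
  moreover have "?F \<inter> {x \<in> ?F. ?phi x \<in> X} = {x \<in> ?F. ?phi x \<in> X}" by auto
  moreover have "finite X" using X finite_darts[OF M] finite_subset by (auto simp: vertex_union_def)
  ultimately show ?thesis
    unfolding eq using odd_card_sym_diff[of X "{x \<in> ?F. ?phi x \<in> X}" ?F] fin by auto
qed

text \<open>
  Sets of edges, represented by the union of their darts, so that a face that meets an edge from both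
  sides counts it twice.
\<close>

definition edge_sets :: "'a cmap \<Rightarrow> 'a set set" where
  "edge_sets M = {D. D \<subseteq> darts M \<and> (\<forall>d\<in>darts M. opp M d \<in> D \<longleftrightarrow> d \<in> D)}"

lemma finite_edge_sets: "combinatorial_map M \<Longrightarrow> finite (edge_sets M)"
  using finite_darts[of M] by (auto simp: edge_sets_def intro: finite_subset[of _ "Pow (darts M)"])

lemma card_edge_sets:
  assumes M: "combinatorial_map M"
  shows "card (edge_sets M) \<le> 2 ^ card (edges M)"
proof -
  have "edge_sets M \<subseteq> Union ` Pow (edges M)"
  proof
    fix D assume D: "D \<in> edge_sets M"
    have "{d, opp M d} \<subseteq> D" if "d \<in> D" for d
      using D that by (simp add: edge_sets_def subset_iff)
    then have "D = \<Union>((\<lambda>d. {d, opp M d}) ` D)" by blast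
    moreover have "(\<lambda>d. {d, opp M d}) ` D \<subseteq> edges M"
      using D unfolding edge_sets_def edges_def by blast
    ultimately show "D \<in> Union ` Pow (edges M)" by blast
  qed
  moreover have fin: "finite (edges M)" using finite_darts[OF M] by (simp add: edges_def)
  ultimately have "card (edge_sets M) \<le> card (Pow (edges M))"
    by (meson card_image_le card_mono finite_Pow_iff finite_imageI le_trans)
  then show ?thesis using fin by (simp add: card_Pow)
qed

lemma sym_diff_edge_sets:
  assumes M: "combinatorial_map M" and "A \<in> edge_sets M" "B \<in> edge_sets M"
  shows "sym_diff A B \<in> edge_sets M"
  using assms(2,3) by (simp add: edge_sets_def subset_iff)

lemma edge_sets_Un: "A \<in> edge_sets M \<Longrightarrow> B \<in> edge_sets M \<Longrightarrow> A \<union> B \<in> edge_sets M"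
  by (auto simp: edge_sets_def)

lemma edge_in_edge_sets:
  "combinatorial_map M \<Longrightarrow> d \<in> darts M \<Longrightarrow> {d, opp M d} \<in> edge_sets M"
  by (auto simp: edge_sets_def opp_in_iff opp_opp) (metis opp_opp)

lemma mem_face_iff:
  assumes M: "combinatorial_map M" and G: "G \<in> faces M"
  shows "y \<in> G \<longleftrightarrow> face M y = G"
  using G face_eq[OF M] in_face[OF M] unfolding faces_def by blast

lemma mem_vertex_iff:
  assumes M: "combinatorial_map M" and v: "v \<in> vertices M"
  shows "y \<in> v \<longleftrightarrow> vertex M y = v"
  using v vertex_eq[OF M] in_vertex[OF M] unfolding vertices_def by blast

lemma vertex_union_Union:
  "(\<And>X. X \<in> A \<Longrightarrow> vertex_union M X) \<Longrightarrow> vertex_union M (\<Union>A)"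
  unfolding vertex_union_def by blast

text \<open>
  The edges crossed by a path from face to face, starting at the face of \<open>d0\<close> and ending at the
  face of \<open>d\<close>: every other face is entered as often as it is left.
\<close>

lemma dual_path:
  assumes S: "combinatorial_map M" "connected_map M" and d0: "d0 \<in> darts M" and d: "d \<in> darts M"
  shows "\<exists>R\<in>edge_sets M. \<forall>G\<in>faces M - {face M d0}. odd (card (G \<inter> R)) \<longleftrightarrow> G = face M d"
proof -
  note M = S(1)
  have dual_step: "\<exists>R\<in>edge_sets M. \<forall>G\<in>faces M - {face M d0}. odd (card (G \<inter> R)) \<longleftrightarrow> G = face M (opp M x)"
    if x: "x \<in> darts M" and R: "\<exists>R\<in>edge_sets M. \<forall>G\<in>faces M - {face M d0}. odd (card (G \<inter> R)) \<longleftrightarrow> G = face M x" for x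
  proof -
    from R obtain R where R: "R\<in>edge_sets M"
      "\<And>G. G\<in>faces M - {face M d0} \<Longrightarrow> odd (card (G \<inter> R)) \<longleftrightarrow> G = face M x" by blast
    have "odd (card (G \<inter> {x, opp M x})) \<longleftrightarrow> (G = face M x) \<noteq> (G = face M (opp M x))"
      if "G \<in> faces M" for G
      using mem_face_iff[OF M that, of x] mem_face_iff[OF M that, of "opp M x"] opp_neq[OF M x]
      by (simp add: Int_insert_right eq_commute[of G])
    moreover have "finite R" using R(1) finite_darts[OF M] by (auto simp: edge_sets_def intro: finite_subset)
    ultimately have "odd (card (G \<inter> sym_diff R {x, opp M x})) \<longleftrightarrow> G = face M (opp M x)"
      if "G \<in> faces M - {face M d0}" for G
      using that R(2)[OF that] odd_card_sym_diff[of R "{x, opp M x}" G] by blast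
    then show ?thesis using sym_diff_edge_sets[OF M R(1) edge_in_edge_sets[OF M x]] by blast
  qed
  have "(d0, d) \<in> (step_rel M)\<^sup>*" using S(2) d0 d by (auto simp: connected_map_def)
  then show ?thesis
  proof (induction rule: rtrancl_induct)
    case base
    show ?case by (rule bexI[of _ "{}"]) (auto simp: edge_sets_def)
  next
    case (step y z)
    have y: "y \<in> darts M" using step.hyps(2) by (auto simp: step_rel_def)
    have "face M (opp M y) = face M z" if "z = rot M y"
    proof -
      have "z \<in> face M (opp M y)" unfolding face_def using that opp_opp[OF M y] by (intro orbit_eqI(1)) simp
      then show ?thesis by (rule face_eq[OF M, symmetric])
    qed
    then have "face M z = face M (opp M y)" using step.hyps(2) by (auto simp: step_rel_def)
    then show ?case using dual_step[OF y step.IH] by simp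
  qed
qed

text \<open>
  A family of closed curves on the sphere that avoids the vertices separates them into two classes.
  Such a family meets every face in an even number of darts, and the claim is that every set of edges
  with this property is the edge cut of a set of vertices.  Edge cuts have the property, so it
  suffices to compare numbers, where \<open>V\<close>, \<open>E\<close>, \<open>F\<close> count vertices, edges and faces.  Since the graph
  is connected, there are at least \<open>2\<^sup>V\<^sup>-\<^sup>1\<close> edge cuts.  The parities at all faces but one can be
  prescribed at will by superposing paths to the remaining face, so at most one in \<open>2\<^sup>F\<^sup>-\<^sup>1\<close> of the
  \<open>2\<^sup>E\<close> sets of edges is even at every face.  By Euler's formula \<open>E - (F - 1) = V - 1\<close>.
\<close>

lemma even_dual_curve_bounds:
  assumes S: "connected_sphere_map M" and D: "D \<in> edge_sets M"
    and even: "\<And>d. d \<in> darts M \<Longrightarrow> even (card (face M d \<inter> D))"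
  obtains X where "vertex_union M X" "coboundary M X = D"
proof -
  have M: "combinatorial_map M" and conn: "connected_map M" and ne: "darts M \<noteq> {}"
    and euler: "card (vertices M) + card (faces M) = card (edges M) + 2"
    using S by (auto simp: connected_sphere_map_def)
  obtain d0 where d0: "d0 \<in> darts M" using ne by blast
  note fin = finite_darts[OF M]
  define even_sets where "even_sets = {D \<in> edge_sets M. \<forall>d\<in>darts M. even (card (face M d \<inter> D))}"
  define K where "K = faces M - {face M d0}"
  define W where "W = vertices M - {vertex M d0}"
  have fin_faces: "finite (faces M)" and fin_vertices: "finite (vertices M)"
    using fin by (auto simp: faces_def vertices_def)
  have fin_even: "finite even_sets" using finite_edge_sets[OF M] by (simp add: even_sets_def)
  have fin_es: "finite A" if "A \<in> edge_sets M" for A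
    using that fin by (auto simp: edge_sets_def intro: finite_subset)

  \<comment> \<open>every pattern \<open>J\<close> of parities on the faces other than that of \<open>d0\<close> is realized\<close>
  have "\<exists>R\<in>edge_sets M. \<forall>G\<in>K. odd (card (G \<inter> R)) \<longleftrightarrow> G \<in> J" if "J \<subseteq> K" for J
  proof -
    have "finite J" using that fin_faces finite_subset by (auto simp: K_def)
    then show ?thesis using that
    proof (induction J)
      case empty
      show ?case by (rule bexI[of _ "{}"]) (auto simp: edge_sets_def)
    next
      case (insert F J)
      then obtain R where R: "R \<in> edge_sets M" "\<And>G. G \<in> K \<Longrightarrow> odd (card (G \<inter> R)) \<longleftrightarrow> G \<in> J" by blast
      obtain d where d: "d \<in> darts M" "F = face M d" using insert.prems by (auto simp: K_def faces_def)
      obtain R' where R': "R' \<in> edge_sets M" "\<And>G. G \<in> K \<Longrightarrow> odd (card (G \<inter> R')) \<longleftrightarrow> G = F"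
        using dual_path[OF M conn d0 d(1)] unfolding K_def d(2) by blast
      have "odd (card (G \<inter> sym_diff R R')) \<longleftrightarrow> G \<in> insert F J" if "G \<in> K" for G
        using R(2)[OF that] R'(2)[OF that] insert.hyps(2)
        unfolding odd_card_sym_diff[OF fin_es[OF R(1)] fin_es[OF R'(1)]] by blast
      then show ?case using sym_diff_edge_sets[OF M R(1) R'(1)] by blast
    qed
  qed
  then obtain R where R: "\<And>J. J \<subseteq> K \<Longrightarrow> R J \<in> edge_sets M"
    "\<And>J G. J \<subseteq> K \<Longrightarrow> G \<in> K \<Longrightarrow> odd (card (G \<inter> R J)) \<longleftrightarrow> G \<in> J" by metis
  \<comment> \<open>the parities of \<open>sym_diff A (R J)\<close> determine \<open>J\<close>, and then \<open>A\<close>\<close>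
  have "inj_on (\<lambda>(A, J). sym_diff A (R J)) (even_sets \<times> Pow K)"
  proof (rule inj_onI, clarify)
    fix A J A' J'
    assume A: "A \<in> even_sets" "A' \<in> even_sets" and J: "J \<subseteq> K" "J' \<subseteq> K"
      and eq: "sym_diff A (R J) = sym_diff A' (R J')"
    have odd: "odd (card (G \<inter> sym_diff B (R I))) \<longleftrightarrow> G \<in> I"
      if B: "B \<in> even_sets" and I: "I \<subseteq> K" and G: "G \<in> K" for B I G
    proof -
      have "even (card (G \<inter> B))" "B \<in> edge_sets M" using B G by (auto simp: even_sets_def K_def faces_def)
      then show ?thesis using R[OF I] G odd_card_sym_diff fin_es by metis
    qed
    have "J = J'" using odd[OF A(1) J(1)] odd[OF A(2) J(2)] J unfolding eq by blast
    with eq show "A = A' \<and> J = J'" by blast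
  qed
  moreover have "(\<lambda>(A, J). sym_diff A (R J)) ` (even_sets \<times> Pow K) \<subseteq> edge_sets M"
  proof clarify
    fix A J assume "A \<in> even_sets" "J \<subseteq> K"
    then show "sym_diff A (R J) \<in> edge_sets M"
      by (intro sym_diff_edge_sets[OF M] R(1)) (auto simp: even_sets_def)
  qed
  ultimately have "card (even_sets \<times> Pow K) \<le> card (edge_sets M)"
    using card_inj_on_le finite_edge_sets[OF M] by blast
  also have "\<dots> \<le> 2 ^ card (edges M)" by (rule card_edge_sets[OF M])
  finally have upper: "card even_sets * 2 ^ card K \<le> 2 ^ card (edges M)"
    using fin_faces by (simp add: card_cartesian_product card_Pow K_def)

  have vu: "vertex_union M (\<Union>V)" if "V \<subseteq> W" for V
    using that vertex_union_vertex[OF M] by (intro vertex_union_Union) (auto simp: W_def vertices_def)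
  \<comment> \<open>an edge cut determines its two sides, and \<open>d0\<close> tells which of them is \<open>\<Union>V\<close>\<close>
  have "inj_on (\<lambda>V. coboundary M (\<Union>V)) (Pow W)"
  proof (rule inj_onI)
    fix V V' assume V: "V \<in> Pow W" "V' \<in> Pow W" and eq: "coboundary M (\<Union>V) = coboundary M (\<Union>V')"
    have rep: "vertex M d \<in> U \<longleftrightarrow> d \<in> \<Union>U" if "U \<subseteq> W" for U d
    proof
      show "d \<in> \<Union>U" if "vertex M d \<in> U" using that in_vertex[OF M] by blast
      show "vertex M d \<in> U" if "d \<in> \<Union>U"
      proof -
        from that obtain u where u: "u \<in> U" "d \<in> u" by blast
        then have "u \<in> vertices M" using \<open>U \<subseteq> W\<close> by (auto simp: W_def)
        then show ?thesis using u mem_vertex_iff[OF M] by metis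
      qed
    qed
    have d0_notin: "d0 \<notin> \<Union>U" if "U \<subseteq> W" for U
      using rep[OF that, of d0] that by (auto simp: W_def)
    have agree: "d \<in> \<Union>V \<longleftrightarrow> d \<in> \<Union>V'" if d: "d \<in> darts M" for d
    proof -
      have "(d0, d) \<in> (step_rel M)\<^sup>*" using conn d0 d by (auto simp: connected_map_def)
      then show ?thesis
      proof (induction rule: rtrancl_induct)
        case base
        show ?case using d0_notin V by simp
      next
        case (step y z)
        then have y: "y \<in> darts M" by (auto simp: step_rel_def)
        consider "z = rot M y" | "z = opp M y" using step.hyps(2) by (auto simp: step_rel_def)
        then show ?case
        proof cases
          case 1
          then show ?thesis using step.IH vertex_union_rot_iff[OF M vu] V by simp
        next
          case 2
          have "y \<in> coboundary M (\<Union>V) \<longleftrightarrow> y \<in> coboundary M (\<Union>V')" using eq by simp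
          then show ?thesis using step.IH y 2 unfolding coboundary_def by blast
        qed
      qed
    qed
    have "v \<in> V \<longleftrightarrow> v \<in> V'" if "v \<in> W" for v
    proof -
      obtain d where d: "d \<in> darts M" "v = vertex M d" using \<open>v \<in> W\<close> by (auto simp: W_def vertices_def)
      show ?thesis using agree[OF d(1)] rep V unfolding d(2) by (metis PowD)
    qed
    with V show "V = V'" by blast
  qed
  then have card_W: "card ((\<lambda>V. coboundary M (\<Union>V)) ` Pow W) = 2 ^ card W"
    using fin_vertices by (simp add: card_image card_Pow W_def)
  have "coboundary M X \<in> even_sets" if "vertex_union M X" for X
  proof -
    have "opp M d \<in> coboundary M X \<longleftrightarrow> d \<in> coboundary M X" if "d \<in> darts M" for d
      using opp_opp[OF M that] opp_in_iff[OF M, of d] by (auto simp: coboundary_def)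
    then show ?thesis using even_face_coboundary[OF M that]
      by (simp add: even_sets_def edge_sets_def coboundary_def)
  qed
  then have sub: "(\<lambda>V. coboundary M (\<Union>V)) ` Pow W \<subseteq> even_sets" using vu by auto

  have "card (vertices M) = Suc (card W)" "card (faces M) = Suc (card K)"
    unfolding W_def K_def
    by (rule card.remove, simp add: fin_vertices fin_faces, simp add: d0 vertices_def faces_def)+
  with euler have "card (edges M) = card W + card K" by simp
  with upper have "card even_sets \<le> 2 ^ card W" by (simp add: power_add)
  then have "(\<lambda>V. coboundary M (\<Union>V)) ` Pow W = even_sets"
    using card_W fin_even sub by (intro card_seteq) auto
  moreover have "D \<in> even_sets" using D even by (simp add: even_sets_def)
  ultimately obtain V where "V \<subseteq> W" "coboundary M (\<Union>V) = D" by (metis (no_types, lifting) PowD imageE)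
  with vu that show thesis by blast
qed

section \<open>Primeness is 4-edge-connectivity\<close>


definition even_vertices :: "'a cmap \<Rightarrow> bool" where
  "even_vertices M \<longleftrightarrow> (\<forall>v\<in>vertices M. even (card v))"

text \<open>
  The two crossing points of a circle lie on at most two edges, which form a cut by
  \<open>even_dual_curve_bounds\<close>.  A circle that crosses the same edge twice in the same direction would
  make this edge a bridge; the argument covers it as the case \<open>d = d'\<close>.
\<close>

lemma four_edge_connected_imp_prime:
  assumes S: "connected_sphere_map M" and fc: "four_edge_connected M"
  shows "prime_map M"
  unfolding prime_map_def
proof (intro allI impI, rule ccontr)
  fix d d' assume c: "two_point_circle M d d'" and neq: "d' \<noteq> opp M d"
  have M: "combinatorial_map M" using S by (auto simp: connected_sphere_map_def)
  define D where "D = {d, opp M d, d', opp M d'}"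
  have d: "d \<in> darts M" "d' \<in> darts M"
    and f: "face M (opp M d) = face M d'" "face M (opp M d') = face M d"
    using c by (auto simp: two_point_circle_def)
  note neqs = neq opp_neq[OF M d(1)] opp_neq[OF M d(2)] opp_opp[OF M d(1)] opp_opp[OF M d(2)]
  have D_es: "D \<in> edge_sets M" 
    using edge_sets_Un[OF edge_in_edge_sets[OF M d(1)] edge_in_edge_sets[OF M d(2)]] by (simp add: D_def insert_commute)
  have "even (card (F \<inter> D))" if "F \<in> faces M" for F
  proof -
    have sides: "opp M d' \<in> F \<longleftrightarrow> d \<in> F" "opp M d \<in> F \<longleftrightarrow> d' \<in> F"
      by (simp_all add: mem_face_iff[OF M that] f)
    \<comment> \<open>whenever the circle enters a face, it also leaves it\<close>
    have FD: "F \<inter> D = (if d \<in> F then {d, opp M d'} else {}) \<union> (if d' \<in> F then {d', opp M d} else {})"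
      (is "_ = ?A \<union> ?B") unfolding D_def
      by (cases "d \<in> F"; cases "d' \<in> F") (simp_all add: sides Int_insert_right insert_commute)
    have ne: "opp M d' \<noteq> d" "opp M d \<noteq> d'" using neqs by metis+
    have ev: "even (card ?A)" "even (card ?B)"
      using ne ne[symmetric] by (simp_all add: card_insert_if)
    have "?A = ?B \<or> ?A \<inter> ?B = {}"
    proof (cases "d = d'")
      case True
      show ?thesis unfolding True by (simp add: insert_commute)
    next
      case False
      moreover have "opp M d \<noteq> opp M d'" using neqs False by metis
      ultimately show ?thesis using ne neqs(1-3) by simp
    qed
    then show ?thesis
    proof
      assume "?A = ?B"
      then have "F \<inter> D = ?A" using FD by blast
      then show ?thesis using ev(1) by argo
    next
      assume "?A \<inter> ?B = {}"
      then have "card (F \<inter> D) = card ?A + card ?B" unfolding FD by (intro card_Un_disjoint) simp_all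
      then show ?thesis using ev by (metis even_add)
    qed
  qed
  then obtain X where X: "vertex_union M X" "coboundary M X = D"
    using even_dual_curve_bounds[OF S D_es] by (auto simp: faces_def)
  have XM: "X \<subseteq> darts M" using X(1) by (simp add: vertex_union_def)
  have "card D \<le> 4" using card_length[of "[d, opp M d, d', opp M d']"] by (simp add: D_def)
  then have "card (out_darts M X) < 4" using card_coboundary[OF M XM] X(2) by simp
  then have "X = {} \<or> X = darts M" using four_edge_connectedD[OF fc X(1)] by blast
  then have "D = {}" using X(2) opp_in_iff[OF M] by (auto simp: coboundary_def)
  then show False by (simp add: D_def)
qed

text \<open>
  A cut of fewer than four edges consists of two edges by parity and connectedness.  A face on one
  side of the first edge meets the cut evenly and is not also on the other side of that edge, hence
  it contains one side of the second edge; so a circle through two faces crosses the two edges.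
\<close>

lemma prime_imp_four_edge_connected:
  assumes S: "connected_sphere_map M" and ev: "even_vertices M" and prime: "prime_map M"
  shows "four_edge_connected M"
  unfolding four_edge_connected_def
proof (intro allI impI, rule ccontr)
  fix X assume X: "vertex_union M X \<and> X \<noteq> {} \<and> X \<noteq> darts M" and small: "\<not> 4 \<le> card (out_darts M X)"
  have M: "combinatorial_map M" and conn: "connected_map M"
    using S by (auto simp: connected_sphere_map_def)
  have vX: "vertex_union M X" and XM: "X \<subseteq> darts M" using X by (auto simp: vertex_union_def)
  have "out_darts M X \<noteq> {}"
  proof
    assume empty: "out_darts M X = {}"
    obtain x where x: "x \<in> X" using X by blast
    have "y \<in> X" if "y \<in> darts M" for y
    proof -
      have "(x, y) \<in> (step_rel M)\<^sup>*" using conn x that XM by (auto simp: connected_map_def)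
      then show ?thesis
      proof (induction rule: rtrancl_induct)
        case base
        show ?case by (rule x)
      next
        case (step y z)
        then consider "z = rot M y" | "z = opp M y" by (auto simp: step_rel_def)
        then show ?case
        proof cases
          case 1
          then show ?thesis using step.IH vX by (simp add: vertex_union_def)
        next
          case 2
          have "y \<notin> out_darts M X" using empty by simp
          then show ?thesis using step.IH 2 by (simp add: out_darts_def)
        qed
      qed
    qed
    then show False using X XM by blast
  qed
  moreover have "even (card (out_darts M X))"
    using even_out_darts[OF M _ vX] ev by (auto simp: even_vertices_def)
  moreover have "finite (out_darts M X)" by (rule finite_out_darts[OF M XM])
  ultimately have "card (out_darts M X) = 2"
    using small card_0_eq[of "out_darts M X"] by presburger
  then obtain x y where out: "out_darts M X = {x, y}" and xy: "x \<noteq> y" by (auto simp: card_2_iff)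
  have x: "x \<in> darts M" "x \<in> X" "opp M x \<notin> X" and y: "y \<in> darts M" "y \<in> X" "opp M y \<notin> X"
    using out XM by (auto simp: out_darts_def)
  have cob: "coboundary M X = {x, y, opp M x, opp M y}"
  proof -
    have "coboundary M X = out_darts M X \<union> out_darts M (darts M - X)"
      using XM opp_in_iff[OF M] by (auto simp: coboundary_def out_darts_def)
    then show ?thesis using out_darts_complement[OF M XM] out by auto
  qed
  have no_circle: "\<not> two_point_circle M z z'" if "z' \<noteq> opp M z" for z z'
    using prime that by (auto simp: prime_map_def)
  \<comment> \<open>if an edge had the same face on both sides, a circle could cross it once and close up\<close>
  have bridge: "face M (opp M z) \<noteq> face M z" if "z \<in> darts M" for z
    using no_circle[of z z] opp_neq[OF M that] that by (auto simp: two_point_circle_def)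
  have mem: "z \<in> face M w \<longleftrightarrow> face M z = face M w" for z w
    using face_eq[OF M] in_face[OF M] by metis
  have ev_face: "even (card (face M z \<inter> {x, y, opp M x, opp M y}))" if "z \<in> darts M" for z
    using even_face_coboundary[OF M vX that] cob by simp
  have neqs: "opp M x \<noteq> x" "opp M y \<noteq> y" "opp M x \<noteq> y" "opp M y \<noteq> x" "opp M x \<noteq> opp M y"
    using opp_neq[OF M] opp_opp[OF M x(1)] opp_opp[OF M y(1)] x y xy by (blast, blast, blast, blast, metis)
  have one: "(face M y = face M x) \<noteq> (face M (opp M y) = face M x)"
    using ev_face[OF x(1)] bridge[OF x(1)] neqs neqs[symmetric] xy xy[symmetric]
    by (cases "face M y = face M x"; cases "face M (opp M y) = face M x")
      (simp_all add: mem Int_insert_right)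
  have two: "(face M y = face M (opp M x)) \<noteq> (face M (opp M y) = face M (opp M x))"
    using ev_face[of "opp M x"] x(1) opp_in_iff[OF M, of x] bridge[OF x(1), symmetric]
      neqs neqs[symmetric] xy xy[symmetric]
    by (cases "face M y = face M (opp M x)"; cases "face M (opp M y) = face M (opp M x)")
      (simp_all add: mem Int_insert_right)
  show False
  proof (cases "face M y = face M x")
    case True
    with two bridge[OF x(1)] have "face M (opp M y) = face M (opp M x)" by metis
    with True have "two_point_circle M x (opp M y)"
      using x(1) y(1) by (simp add: two_point_circle_def opp_in_iff[OF M] opp_opp[OF M])
    then show False using no_circle neqs by metis
  next
    case False
    with one have *: "face M (opp M y) = face M x" by blast
    with two bridge[OF x(1)] have "face M y = face M (opp M x)" by metis
    with * have "two_point_circle M x y" using x(1) y(1) by (simp add: two_point_circle_def)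
    then show False using no_circle neqs by metis
  qed
qed

section \<open>One of the three splittings of a 6-valent vertex keeps 4-edge-connectivity\<close>

text \<open>
  Let the vertex \<open>v\<close> be replaced by two vertices, one with the darts \<open>H\<close> and one with the others,
  joined by a new edge.  An \<open>obstruction\<close> is what a cut of two edges through the new edge leaves in
  the original graph: a set of darts that respects all vertices but \<open>v\<close>, is split as prescribed at
  \<open>v\<close>, and is left by at most one of the original edges.
\<close>

definition obstruction :: "'a cmap \<Rightarrow> 'a set \<Rightarrow> 'a set \<Rightarrow> 'a set \<Rightarrow> bool" where
  "obstruction M v H T \<longleftrightarrow>
     T \<subseteq> darts M \<and> (\<forall>d\<in>darts M - v. rot M d \<in> T \<longleftrightarrow> d \<in> T) \<and> T \<inter> v = H \<and>
     card (out_darts M T) \<le> 1"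

lemma obstructionD:
  assumes "obstruction M v H T"
  shows "T \<subseteq> darts M" and "\<And>d. d \<in> darts M - v \<Longrightarrow> rot M d \<in> T \<longleftrightarrow> d \<in> T"
    and "T \<inter> v = H" and "card (out_darts M T) \<le> 1"
  using assms by (simp_all add: obstruction_def)

text \<open>
  Exchanging the two sides, so that a splitting of the vertex may be described by either half.
\<close>

lemma obstruction_complement:
  assumes M: "combinatorial_map M" and v: "v \<subseteq> darts M" and T: "obstruction M v H T"
  shows "obstruction M v (v - H) (darts M - T)"
  using assms card_out_darts_complement[OF M, of T] rot_in_iff[OF M]
  unfolding obstruction_def by auto

locale six_valent =
  fixes M :: "'a cmap" and a0 a1 a2 a3 a4 a5 :: 'a
  assumes M: "combinatorial_map M" and a0_in: "a0 \<in> darts M"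
    and rots: "rot M a0 = a1" "rot M a1 = a2" "rot M a2 = a3" "rot M a3 = a4" "rot M a4 = a5" "rot M a5 = a0"
    and dist: "distinct [a0, a1, a2, a3, a4, a5]"
begin

abbreviation "v \<equiv> {a0, a1, a2, a3, a4, a5}"

lemma dist_rev: "distinct [a5, a4, a3, a2, a1, a0]"
  using dist by auto

lemma v_darts: "v \<subseteq> darts M"
proof -
  have "a1 \<in> darts M" using rots(1) a0_in rot_in_iff[OF M] by metis
  moreover from this have "a2 \<in> darts M" using rots(2) rot_in_iff[OF M] by metis
  moreover from this have "a3 \<in> darts M" using rots(3) rot_in_iff[OF M] by metis
  moreover from this have "a4 \<in> darts M" using rots(4) rot_in_iff[OF M] by metis
  moreover from this have "a5 \<in> darts M" using rots(5) rot_in_iff[OF M] by metis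
  ultimately show ?thesis using a0_in by simp
qed

lemma rotated: "six_valent M a1 a2 a3 a4 a5 a0"
  using M v_darts rots dist by unfold_locales auto

lemma vertex_union_v: "vertex_union M v"
  using v_darts by (simp add: vertex_union_def rots)

lemma vertex_union_off_v:
  assumes "\<And>d. d \<in> darts M - v \<Longrightarrow> rot M d \<in> Y \<longleftrightarrow> d \<in> Y"
  shows "vertex_union M (darts M \<inter> Y - v)"
  unfolding vertex_union_def
proof (intro conjI ballI)
  fix d assume "d \<in> darts M \<inter> Y - v"
  then have d: "d \<in> darts M - v" "d \<in> Y" by blast+
  have "rot M d \<in> darts M" "rot M d \<notin> v" "rot M d \<in> Y"
    using d assms[OF d(1)] vertex_union_rot_iff[OF M vertex_union_v] rot_in_iff[OF M] by blast+
  then show "rot M d \<in> darts M \<inter> Y - v" by blast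
qed blast

lemma small_cut_off_v:
  assumes fc: "four_edge_connected M" and X: "vertex_union M X" "a0 \<notin> X"
    and C: "out_darts M X \<subseteq> C" "finite C" "card C \<le> 3"
  shows "X = {}"
proof -
  have "card (out_darts M X) < 4" using card_mono[OF C(2,1)] C(3) by simp
  then show ?thesis using four_edge_connectedD[OF fc X(1)] X(2) a0_in by blast
qed

text \<open>
  Neighbouring splittings are both obstructed only if there is a loop.  Together \<open>T\<close> and \<open>T'\<close>
  partition the other vertices into four classes, and at \<open>v\<close> the dart \<open>a0\<close> belongs only to \<open>T\<close>,
  \<open>a3\<close> only to \<open>T'\<close>, \<open>a1\<close> and \<open>a2\<close> to both, \<open>a4\<close> and \<open>a5\<close> to none.  Apart from the edges to
  \<open>v\<close>, a class is left by at most two edges, one crossing each of \<open>T\<close> and \<open>T'\<close>.  So the two classes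
  that are adjacent to \<open>v\<close> by one dart have cuts of at most three edges and are empty.  Then
  the edges of \<open>a0\<close> and \<open>a3\<close> use up the edges across \<open>T\<close> and \<open>T'\<close>, so that one of the other two
  classes has a cut of at most two edges, is empty too, and its two darts at \<open>v\<close> can only be joined to
  each other.
\<close>

lemma uncrossing:
  assumes fc: "four_edge_connected M"
    and T: "obstruction M v {a0, a1, a2} T" and T': "obstruction M v {a1, a2, a3} T'"
  shows "opp M a4 = a5 \<or> opp M a1 = a2"
proof -
  note opp_opp' = opp_opp[OF M] and opp_in = opp_in_iff[OF M]
  let ?C = "out_darts M T" and ?C' = "out_darts M T'"
  note sub = obstructionD(1)[OF T] obstructionD(1)[OF T']
  note rotT = obstructionD(2)[OF T] and rotT' = obstructionD(2)[OF T']
  note Tv = obstructionD(3)[OF T] obstructionD(3)[OF T']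
  note card_C = obstructionD(4)[OF T] obstructionD(4)[OF T']
  have fin: "finite ?C" "finite ?C'" using finite_out_darts[OF M] sub by blast+
  have one: "x = y" if "x \<in> ?C" "y \<in> ?C" for x y
    using that card_C(1) card_le_Suc0_iff_eq[OF fin(1)] by simp
  have one': "x = y" if "x \<in> ?C'" "y \<in> ?C'" for x y
    using that card_C(2) card_le_Suc0_iff_eq[OF fin(2)] by simp
  have mem: "x \<in> T \<longleftrightarrow> x \<in> {a0, a1, a2}" "x \<in> T' \<longleftrightarrow> x \<in> {a1, a2, a3}" if "x \<in> v" for x
    using that Tv by blast+
  have aT: "a0 \<in> T" "a1 \<in> T" "a2 \<in> T" "a3 \<notin> T" "a4 \<notin> T" "a5 \<notin> T"
    by (subst mem(1), simp, use dist dist_rev in simp)+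
  have aT': "a0 \<notin> T'" "a1 \<in> T'" "a2 \<in> T'" "a3 \<in> T'" "a4 \<notin> T'" "a5 \<notin> T'"
    by (subst mem(2), simp, use dist dist_rev in simp)+
  have at10: "x = a0" if "x \<in> v" "x \<in> T" "x \<notin> T'" for x
    using that(2,3) unfolding mem[OF that(1)] by blast
  have at01: "x = a3" if "x \<in> v" "x \<in> T'" "x \<notin> T" for x
    using that(2,3) unfolding mem[OF that(1)] by blast
  have at11: "x = a1 \<or> x = a2" if "x \<in> v" "x \<in> T" "x \<in> T'" for x
  proof -
    have "x \<noteq> a0" using that(3) aT'(1) by blast
    then show ?thesis using that(2) unfolding mem[OF that(1)] by blast
  qed
  have at00: "x = a4 \<or> x = a5" if "x \<in> v" "x \<notin> T" "x \<notin> T'" for x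
    using that(2,3) unfolding mem[OF that(1)] using that(1) by blast
  have a_in: "a0 \<in> darts M" "a1 \<in> darts M" "a2 \<in> darts M" "a3 \<in> darts M" "a4 \<in> darts M" "a5 \<in> darts M"
    using v_darts by simp_all
  have leave: "d \<in> ?C" if "d \<in> T" "opp M d \<notin> T" for d using that by (simp add: out_darts_def)
  have leave': "d \<in> ?C'" if "d \<in> T'" "opp M d \<notin> T'" for d using that by (simp add: out_darts_def)
  have enter: "opp M d \<in> ?C" if "d \<in> darts M" "d \<notin> T" "opp M d \<in> T" for d
    using that opp_opp' by (simp add: out_darts_def)
  have enter': "opp M d \<in> ?C'" if "d \<in> darts M" "d \<notin> T'" "opp M d \<in> T'" for d
    using that opp_opp' by (simp add: out_darts_def)
  have flip: "d = opp M e" if "opp M d = e" "d \<in> darts M" for d e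
    using that opp_opp' by metis
  have card3: "card (insert b (A \<union> opp M ` B)) \<le> 3" if "card A \<le> 1" "card B \<le> 1" "finite A" "finite B" for b A B
  proof -
    have "card (A \<union> opp M ` B) \<le> card A + card (opp M ` B)" by (rule card_Un_le)
    also have "\<dots> \<le> 2" using that card_image_le[OF that(4), of "opp M"] by linarith
    finally show ?thesis using card_insert_le_m1[of 3] that by simp
  qed

  have X10: "darts M \<inter> (T - T') - v = {}"
  proof (rule small_cut_off_v[OF fc])
    show "vertex_union M (darts M \<inter> (T - T') - v)" by (rule vertex_union_off_v) (simp add: rotT rotT')
    show "a0 \<notin> darts M \<inter> (T - T') - v" by simp
    show "out_darts M (darts M \<inter> (T - T') - v) \<subseteq> insert (opp M a0) (?C \<union> opp M ` ?C')"
    proof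
      fix d assume "d \<in> out_darts M (darts M \<inter> (T - T') - v)"
      then have d: "d \<in> darts M" "d \<in> T" "d \<notin> T'" and o: "opp M d \<notin> T \<or> opp M d \<in> T' \<or> opp M d \<in> v"
        using opp_in[of d] unfolding out_darts_def by blast+
      consider "opp M d \<notin> T" | "opp M d \<in> T'" | "opp M d \<in> T" "opp M d \<notin> T'" "opp M d \<in> v" using o by blast
      then show "d \<in> insert (opp M a0) (?C \<union> opp M ` ?C')"
      proof cases
        case 1
        then show ?thesis using leave d by blast
      next
        case 2
        then show ?thesis using enter'[OF d(1,3)] flip[OF refl d(1)] by (metis UnI2 image_eqI insertI2)
      next
        case 3
        then have "opp M d = a0" using at10 by blast
        then show ?thesis using flip[OF _ d(1)] by blast
      qed
    qed
  qed (simp add: fin, intro card3 card_C fin)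
  have X01: "darts M \<inter> (T' - T) - v = {}"
  proof (rule small_cut_off_v[OF fc])
    show "vertex_union M (darts M \<inter> (T' - T) - v)" by (rule vertex_union_off_v) (simp add: rotT rotT')
    show "a0 \<notin> darts M \<inter> (T' - T) - v" by simp
    show "out_darts M (darts M \<inter> (T' - T) - v) \<subseteq> insert (opp M a3) (?C' \<union> opp M ` ?C)"
    proof
      fix d assume "d \<in> out_darts M (darts M \<inter> (T' - T) - v)"
      then have d: "d \<in> darts M" "d \<in> T'" "d \<notin> T" and o: "opp M d \<notin> T' \<or> opp M d \<in> T \<or> opp M d \<in> v"
        using opp_in[of d] unfolding out_darts_def by blast+
      consider "opp M d \<notin> T'" | "opp M d \<in> T" | "opp M d \<in> T'" "opp M d \<notin> T" "opp M d \<in> v" using o by blast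
      then show "d \<in> insert (opp M a3) (?C' \<union> opp M ` ?C)"
      proof cases
        case 1
        then show ?thesis using leave' d by blast
      next
        case 2
        then show ?thesis using enter[OF d(1,3)] flip[OF refl d(1)] by (metis UnI2 image_eqI insertI2)
      next
        case 3
        then have "opp M d = a3" using at01 by blast
        then show ?thesis using flip[OF _ d(1)] by blast
      qed
    qed
  qed (simp add: fin, intro card3 card_C fin)

  have "opp M a0 \<notin> T \<or> opp M a0 \<in> T'"
  proof (rule ccontr)
    assume "\<not> ?thesis"
    then have o: "opp M a0 \<in> T" "opp M a0 \<notin> T'" by blast+
    then have "opp M a0 \<in> v" using X10 sub by blast
    then have "opp M a0 = a0" using at10 o by blast
    then show False using opp_neq[OF M a0_in] by blast
  qed
  then have end0: "a0 \<in> ?C \<or> opp M a0 \<in> ?C'"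
    using leave[OF aT(1)] enter'[OF a_in(1) aT'(1)] by blast
  have "opp M a3 \<notin> T' \<or> opp M a3 \<in> T"
  proof (rule ccontr)
    assume "\<not> ?thesis"
    then have o: "opp M a3 \<in> T'" "opp M a3 \<notin> T" by blast+
    then have "opp M a3 \<in> v" using X01 sub by blast
    then have "opp M a3 = a3" using at01 o by blast
    then show False using opp_neq[OF M a_in(4)] by blast
  qed
  then have end3: "a3 \<in> ?C' \<or> opp M a3 \<in> ?C"
    using leave'[OF aT'(4)] enter[OF a_in(4) aT(4)] by blast

  \<comment> \<open>the edges of \<open>a0\<close> and \<open>a3\<close> end outside both sets or join \<open>a0\<close> to \<open>a3\<close>, so no edge
  leaves the intersection\<close>
  have inner: "opp M a1 = a2" if C: "a0 \<in> ?C" "a3 \<in> ?C'"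
  proof -
    have X11: "darts M \<inter> (T \<inter> T') - v = {}"
    proof (rule small_cut_off_v[OF fc])
      show "vertex_union M (darts M \<inter> (T \<inter> T') - v)" by (rule vertex_union_off_v) (simp add: rotT rotT')
      show "out_darts M (darts M \<inter> (T \<inter> T') - v) \<subseteq> {opp M a1, opp M a2}"
      proof
        fix d assume "d \<in> out_darts M (darts M \<inter> (T \<inter> T') - v)"
        then have d: "d \<in> darts M" "d \<in> T" "d \<in> T'" "d \<notin> v"
          and o: "opp M d \<notin> T \<or> opp M d \<notin> T' \<or> opp M d \<in> v"
          using opp_in[of d] unfolding out_darts_def by blast+
        have "opp M d \<in> T" using leave[OF d(2)] one[OF C(1)] d(4) by blast
        moreover have "opp M d \<in> T'" using leave'[OF d(3)] one'[OF C(2)] d(4) by blast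
        ultimately have "opp M d = a1 \<or> opp M d = a2" using o at11 by blast
        then show "d \<in> {opp M a1, opp M a2}" using flip[OF _ d(1)] by blast
      qed
    qed (simp_all add: card_insert_if)
    have "opp M a1 \<in> T" using leave[OF aT(2)] one[OF C(1)] dist by auto
    moreover have "opp M a1 \<in> T'" using leave'[OF aT'(2)] one'[OF C(2)] dist by auto
    ultimately have "opp M a1 \<in> v" using X11 sub by blast
    then show ?thesis using \<open>opp M a1 \<in> T\<close> \<open>opp M a1 \<in> T'\<close> at11 opp_neq[OF M a_in(2)] by blast
  qed
  \<comment> \<open>the edges of \<open>a0\<close> and \<open>a3\<close> end in both sets or join \<open>a0\<close> to \<open>a3\<close>, so no edge
  leads into the union from outside\<close>
  have outer: "opp M a4 = a5" if C: "opp M a0 \<in> ?C'" "opp M a3 \<in> ?C"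
  proof -
    have notT: "opp M d \<notin> T" if "d \<in> darts M" "d \<notin> T" "d \<noteq> a3" for d
      using enter[OF that(1,2)] one[OF C(2)] flip that a_in(4) opp_opp' by metis
    have notT': "opp M d \<notin> T'" if "d \<in> darts M" "d \<notin> T'" "d \<noteq> a0" for d
      using enter'[OF that(1,2)] one'[OF C(1)] flip that a_in(1) opp_opp' by metis
    have X00: "darts M \<inter> (- T \<inter> - T') - v = {}"
    proof (rule small_cut_off_v[OF fc])
      show "vertex_union M (darts M \<inter> (- T \<inter> - T') - v)" by (rule vertex_union_off_v) (simp add: rotT rotT')
      show "out_darts M (darts M \<inter> (- T \<inter> - T') - v) \<subseteq> {opp M a4, opp M a5}"
      proof
        fix d assume "d \<in> out_darts M (darts M \<inter> (- T \<inter> - T') - v)"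
        then have d: "d \<in> darts M" "d \<notin> T" "d \<notin> T'" "d \<notin> v"
          and o: "opp M d \<in> T \<or> opp M d \<in> T' \<or> opp M d \<in> v"
          using opp_in[of d] unfolding out_darts_def by blast+
        have "opp M d \<notin> T" "opp M d \<notin> T'" using notT notT' d by blast+
        then have "opp M d = a4 \<or> opp M d = a5" using o at00 by blast
        then show "d \<in> {opp M a4, opp M a5}" using flip[OF _ d(1)] by blast
      qed
    qed (simp_all add: card_insert_if)
    have "opp M a4 \<notin> T" "opp M a4 \<notin> T'" using notT notT' a_in aT aT' dist by auto
    moreover from this have "opp M a4 \<in> v" using X00 opp_in[of a4] a_in by blast
    ultimately show ?thesis using at00 opp_neq[OF M a_in(5)] by blast
  qed
  consider "a0 \<in> ?C" "a3 \<in> ?C'" | "opp M a0 \<in> ?C'" "opp M a3 \<in> ?C"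
    | "a0 \<in> ?C" "opp M a3 \<in> ?C" | "opp M a0 \<in> ?C'" "a3 \<in> ?C'"
    using end0 end3 by blast
  then show ?thesis
  proof cases
    case 3
    then have "opp M a3 = a0" using one by metis
    then have "a3 \<in> ?C'" using leave'[OF aT'(4)] aT'(1) by metis
    then show ?thesis using inner 3(1) by blast
  next
    case 4
    then have "opp M a0 = a3" using one' by metis
    then have "a0 \<in> ?C" using leave[OF aT(1)] aT(4) by metis
    then show ?thesis using inner 4(2) by blast
  qed (use inner outer in blast)+
qed

text \<open>
  Otherwise \<open>uncrossing\<close> would apply to all three pairs of splittings, and the resulting loops would
  use all six darts of \<open>v\<close>, so that \<open>v\<close> would be the only vertex.
\<close>

lemma one_of_three_splits:
  assumes fc: "four_edge_connected M" and v: "v \<noteq> darts M"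
  shows "\<not> (obstruction M v {a0, a1, a2} T0 \<and> obstruction M v {a1, a2, a3} T1 \<and> obstruction M v {a2, a3, a4} T2)"
proof
  assume T: "obstruction M v {a0, a1, a2} T0 \<and> obstruction M v {a1, a2, a3} T1 \<and> obstruction M v {a2, a3, a4} T2"
  interpret r1: six_valent M a1 a2 a3 a4 a5 a0 by (rule rotated)
  interpret r2: six_valent M a2 a3 a4 a5 a0 a1 by (rule r1.rotated)
  have vs: "{a1, a2, a3, a4, a5, a0} = v" "{a2, a3, a4, a5, a0, a1} = v" by auto
  have "v - {a0, a1, a2} = {a3, a4, a5}" using dist by auto
  then have T3: "obstruction M v {a3, a4, a5} (darts M - T0)"
    using obstruction_complement[OF M v_darts] T by metis
  have "opp M a4 = a5 \<or> opp M a1 = a2" using uncrossing[OF fc] T by blast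
  moreover have "opp M a5 = a0 \<or> opp M a2 = a3" using r1.uncrossing[OF fc] T unfolding vs by blast
  moreover have "opp M a0 = a1 \<or> opp M a3 = a4" using r2.uncrossing[OF fc] T T3 unfolding vs by blast
  moreover have "opp M (opp M a) = a" if "a \<in> v" for a using opp_opp[OF M] v_darts that by blast
  ultimately have "\<forall>a\<in>v. opp M a \<in> v" using dist by simp metis
  then have "out_darts M v = {}" unfolding out_darts_def by blast
  then have "card (out_darts M v) < 4" by simp
  then show False using four_edge_connectedD[OF fc vertex_union_v] v by blast
qed

end

lemma six_valent_vertex:
  assumes M: "combinatorial_map M" and a: "a \<in> darts M" and card: "card (vertex M a) = 6"
  obtains a1 a2 a3 a4 a5 where "six_valent M a a1 a2 a3 a4 a5" "vertex M a = {a, a1, a2, a3, a4, a5}"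
proof -
  let ?f = "rot M" and ?r = "\<lambda>n. (rot M ^^ n) a"
  have self: "a \<in> orbit ?f a" using in_vertex[OF M] by (simp add: vertex_def)
  define k where "k = funpow_dist1 ?f a a"
  have orb: "vertex M a = ?r ` {0..<k}" and inj: "inj_on ?r {0..<k}"
    unfolding k_def vertex_def by (rule orbit_conv_funpow_dist1[OF self] inj_on_funpow_dist1[OF self])+
  have "k = 6" using card card_image[OF inj] orb by simp
  have "?r k = a" unfolding k_def by (rule funpow_dist1_prop[OF self])
  then have r6: "?r 6 = a" using \<open>k = 6\<close> by simp
  have set: "{0..<k} = {0, 1, 2, 3, 4, 5}" using \<open>k = 6\<close> by auto
  have "distinct (map ?r [0, 1, 2, 3, 4, 5])"
    using inj unfolding set by (simp only: distinct_map) simp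
  then have "six_valent M a (?r 1) (?r 2) (?r 3) (?r 4) (?r 5)"
    using M a r6 by unfold_locales (simp_all add: numeral_eq_Suc)
  moreover have "vertex M a = {a, ?r 1, ?r 2, ?r 3, ?r 4, ?r 5}"
    unfolding orb set by simp
  ultimately show thesis by (rule that)
qed

section \<open>Splitting a 6-valent vertex\<close>


lemma orbit_four_cycle:
  assumes "f a = b" "f b = c" "f c = d" "f d = a"
  shows "orbit f a = {a, b, c, d}"
proof
  show "orbit f a \<subseteq> {a, b, c, d}"
  proof
    fix x assume "x \<in> orbit f a"
    then show "x \<in> {a, b, c, d}" by induction (use assms in auto)
  qed
  have "b \<in> orbit f a" using orbit.base[of f a] assms(1) by simp
  moreover from orbit.step[OF this] have "c \<in> orbit f a" using assms(2) by simp
  moreover from orbit.step[OF this] have "d \<in> orbit f a" using assms(3) by simp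
  moreover from orbit.step[OF this] have "a \<in> orbit f a" using assms(4) by simp
  ultimately show "{a, b, c, d} \<subseteq> orbit f a" by simp
qed

text \<open>
  Inserting extra points into the cycles of a permutation: if \<open>g\<close> reaches \<open>f x\<close> from \<open>x\<close> either at
  once or after one stop outside \<open>A\<close>, the cycles of \<open>f\<close> are what remains of those of \<open>g\<close> when the
  extra points are removed.
\<close>

lemma orbit_Int_detour:
  assumes f: "\<And>x. x \<in> A \<Longrightarrow> f x \<in> A"
    and g: "\<And>x. x \<in> A \<Longrightarrow> g x = f x \<or> g x \<notin> A \<and> g (g x) = f x"
    and x: "x \<in> A"
  shows "orbit g x \<inter> A = orbit f x"
proof
  have "(y \<in> A \<longrightarrow> y \<in> orbit f x) \<and> (y \<notin> A \<longrightarrow> g y \<in> A \<inter> orbit f x)" if "y \<in> orbit g x" for y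
    using that
  proof induction
    case base
    then show ?case using g[OF x] f[OF x] orbit.base[of f x] by auto
  next
    case (step y)
    show ?case
    proof (cases "y \<in> A")
      case True
      with step.IH have "f y \<in> A \<inter> orbit f x" using f orbit.step[of y f x] by blast
      then show ?thesis using g[OF True] by auto
    next
      case False
      then show ?thesis using step.IH by blast
    qed
  qed
  then show "orbit g x \<inter> A \<subseteq> orbit f x" by blast
  have "y \<in> orbit g x \<inter> A" if "y \<in> orbit f x" for y
    using that
  proof induction
    case base
    have o: "g x \<in> orbit g x" "g (g x) \<in> orbit g x" by (simp_all add: orbit.intros)
    show ?case using g[OF x]
    proof
      assume "g x = f x" then show ?thesis using o(1) f[OF x] by simp
    next
      assume "g x \<notin> A \<and> g (g x) = f x" then show ?thesis using o(2) f[OF x] by simp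
    qed
  next
    case (step y)
    then have y: "y \<in> A" and o: "g y \<in> orbit g x" "g (g y) \<in> orbit g x" by (simp_all add: orbit.intros)
    show ?case using g[OF y]
    proof
      assume "g y = f y" then show ?thesis using o(1) f[OF y] by simp
    next
      assume "g y \<notin> A \<and> g (g y) = f y" then show ?thesis using o(2) f[OF y] by simp
    qed
  qed
  then show "orbit f x \<subseteq> orbit g x \<inter> A" by blast
qed

lemma image_eq_singleton: "A \<noteq> {} \<Longrightarrow> (\<And>x. x \<in> A \<Longrightarrow> f x = c) \<Longrightarrow> f ` A = {c}"
  by force

lemma card_insert_two:
  "finite R \<Longrightarrow> U \<notin> R \<Longrightarrow> W \<notin> R \<Longrightarrow> U \<noteq> W \<Longrightarrow> card ({U, W} \<union> R) = Suc (Suc (card R))"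
  by simp

text \<open>
  The vertex with the cyclic order \<open>a0, \<dots>, a5\<close> becomes the two vertices \<open>p, a0, a1, a2\<close> and
  \<open>q, a3, a4, a5\<close>, joined by the edge with the halves \<open>p\<close> and \<open>q\<close>.
\<close>

definition split_vertex :: "'a cmap \<Rightarrow> 'a \<Rightarrow> 'a \<Rightarrow> 'a \<Rightarrow> 'a \<Rightarrow> 'a \<Rightarrow> 'a \<Rightarrow> 'a cmap" where
  "split_vertex M a0 a2 a3 a5 p q =
     \<lparr>darts = insert p (insert q (darts M)),
      rot = (rot M)(a2 := p, p := a0, a5 := q, q := a3),
      opp = (opp M)(p := q, q := p)\<rparr>"

locale vertex_split = six_valent +
  fixes p q :: 'a
  assumes pq: "p \<notin> darts M" "q \<notin> darts M" "p \<noteq> q"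
begin

abbreviation "N \<equiv> split_vertex M a0 a2 a3 a5 p q"

lemma not_pq: "d \<in> darts M \<Longrightarrow> d \<noteq> p" "d \<in> darts M \<Longrightarrow> d \<noteq> q"
  using pq by blast+

lemma a_in: "a0 \<in> darts M" "a1 \<in> darts M" "a2 \<in> darts M" "a3 \<in> darts M" "a4 \<in> darts M" "a5 \<in> darts M"
  using v_darts by simp_all

lemmas a_neq_pq = a_in[THEN not_pq(1)] a_in[THEN not_pq(2)]

lemma darts_N: "darts N = insert p (insert q (darts M))"
  by (simp add: split_vertex_def)

lemma rot_N:
  "rot N p = a0" "rot N a0 = a1" "rot N a1 = a2" "rot N a2 = p"
  "rot N q = a3" "rot N a3 = a4" "rot N a4 = a5" "rot N a5 = q"
  using rots dist dist_rev pq a_neq_pq a_neq_pq[symmetric]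
  by (simp_all add: split_vertex_def)

lemma rot_N_other: "d \<noteq> a2 \<Longrightarrow> d \<noteq> a5 \<Longrightarrow> d \<noteq> p \<Longrightarrow> d \<noteq> q \<Longrightarrow> rot N d = rot M d"
  by (simp add: split_vertex_def)

lemma opp_N: "opp N p = q" "opp N q = p"
  using pq by (simp_all add: split_vertex_def)

lemma opp_N_old: "d \<in> darts M \<Longrightarrow> opp N d = opp M d"
  using not_pq[of d] by (simp add: split_vertex_def)

lemma rot_N_permutes: "rot N permutes darts N"
proof -
  have inj: "rot M x = rot M y \<Longrightarrow> x = y" for x y
    using permutes_inj[OF rot_permutes[OF M]] by (auto dest: injD)
  have fixed: "rot M p = p" "rot M q = q"
    using permutes_not_in[OF rot_permutes[OF M]] pq by blast+
  \<comment> \<open>the map \<open>rot N\<close> is \<open>rot M\<close> followed by the 4-cycle that takes \<open>a3\<close> to \<open>p\<close>, \<open>p\<close> to \<open>a0\<close>, \<open>a0\<close> to \<open>q\<close> and \<open>q\<close> to \<open>a3\<close>\<close>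
  have "rot N = Transposition.transpose a3 q \<circ> Transposition.transpose a3 a0 \<circ> Transposition.transpose a3 p \<circ> rot M"
  proof
    fix x
    consider "x = a2" | "x = a5" | "x = p" | "x = q" | "x \<noteq> a2" "x \<noteq> a5" "x \<noteq> p" "x \<noteq> q" by blast
    then show "rot N x = (Transposition.transpose a3 q \<circ> Transposition.transpose a3 a0 \<circ> Transposition.transpose a3 p \<circ> rot M) x"
    proof cases
      case 5
      then have "rot M x \<noteq> a3" "rot M x \<noteq> a0" "rot M x \<noteq> p" "rot M x \<noteq> q"
        using inj[of x] rots fixed by metis+
      then show ?thesis using 5 by (simp add: rot_N_other Transposition.transpose_def)
    qed (use rot_N rots fixed dist dist_rev pq(3) pq(3)[symmetric] a_neq_pq a_neq_pq[symmetric] in \<open>simp_all add: Transposition.transpose_def\<close>)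
  qed
  moreover have "rot M permutes darts N"
    using rot_permutes[OF M] by (rule permutes_subset) (auto simp: darts_N)
  ultimately show ?thesis
    using a_in by (simp only:) (intro permutes_compose permutes_swap_id, simp_all add: darts_N)
qed

lemma opp_N_permutes: "opp N permutes darts N"
proof -
  have fixed: "opp M p = p" "opp M q = q"
    using permutes_not_in[OF opp_permutes[OF M]] pq by blast+
  have "opp N = Transposition.transpose p q \<circ> opp M"
  proof
    fix x
    consider "x = p" | "x = q" | "x \<noteq> p" "x \<noteq> q" by blast
    then show "opp N x = (Transposition.transpose p q \<circ> opp M) x"
    proof cases
      case 3
      then have "opp M x \<noteq> p" "opp M x \<noteq> q"
        using permutes_inj[OF opp_permutes[OF M]] fixed by (metis injD)+
      then show ?thesis using 3 by (simp add: split_vertex_def)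
    qed (simp_all add: opp_N fixed)
  qed
  moreover have "opp M permutes darts N"
    using opp_permutes[OF M] by (rule permutes_subset) (auto simp: darts_N)
  ultimately show ?thesis
    by (simp only:) (intro permutes_compose permutes_swap_id, simp_all add: darts_N)
qed

lemma combinatorial_map_N: "combinatorial_map N"
  unfolding combinatorial_map_def
proof (intro conjI ballI)
  fix d assume "d \<in> darts N"
  then consider "d = p" | "d = q" | "d \<in> darts M" by (auto simp: darts_N)
  then have "opp N d \<noteq> d \<and> opp N (opp N d) = d"
  proof cases
    case 3
    then show ?thesis by (simp add: opp_N_old opp_in_iff[OF M] opp_neq[OF M] opp_opp[OF M])
  qed (use pq(3) in \<open>simp_all add: opp_N\<close>)
  then show "opp N d \<noteq> d" "opp N (opp N d) = d" by blast+
qed (use rot_N_permutes opp_N_permutes finite_darts[OF M] in \<open>simp_all add: darts_N\<close>)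

lemma vertex_v:
  assumes "d \<in> v" shows "vertex M d = v"
proof -
  have "vertex M a0 = v"
  proof
    show "vertex M a0 \<subseteq> v"
    proof
      fix x assume "x \<in> vertex M a0"
      then show "x \<in> v" unfolding vertex_def by induction (use rots in auto)
    qed
    have "a1 \<in> vertex M a0" unfolding vertex_def using orbit.base[of "rot M" a0] rots(1) by simp
    moreover from this have "a2 \<in> vertex M a0" unfolding vertex_def using orbit.step[of a1 "rot M"] rots(2) by simp
    moreover from this have "a3 \<in> vertex M a0" unfolding vertex_def using orbit.step[of a2 "rot M"] rots(3) by simp
    moreover from this have "a4 \<in> vertex M a0" unfolding vertex_def using orbit.step[of a3 "rot M"] rots(4) by simp
    moreover from this have "a5 \<in> vertex M a0" unfolding vertex_def using orbit.step[of a4 "rot M"] rots(5) by simp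
    ultimately show "v \<subseteq> vertex M a0" using in_vertex[OF M, of a0] by simp
  qed
  then show ?thesis using vertex_eq[OF M, of d a0] assms by simp
qed

lemma vertex_N_p: "vertex N p = {p, a0, a1, a2}"
  and vertex_N_q: "vertex N q = {q, a3, a4, a5}"
  unfolding vertex_def by (rule orbit_four_cycle; rule rot_N)+

lemma vertex_N_old:
  assumes d: "d \<in> darts M - v" shows "vertex N d = vertex M d"
  unfolding vertex_def
proof (rule orbit_cong)
  show "d \<in> orbit (rot M) d" using in_vertex[OF M] by (simp add: vertex_def)
  fix x assume "x \<in> orbit (rot M) d"
  then have x: "x \<in> vertex M d" by (simp add: vertex_def)
  then have "vertex M x = vertex M d" by (rule vertex_eq[OF M])
  then have "x \<notin> v" using vertex_v[of x] in_vertex[OF M, of d] d by blast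
  moreover have "x \<in> darts M" using x vertex_subset[OF M, of d] d by blast
  ultimately show "rot N x = rot M x" using not_pq by (intro rot_N_other) auto
qed

lemma vertices_N: "vertices N = {{p, a0, a1, a2}, {q, a3, a4, a5}} \<union> (vertices M - {v})"
proof -
  note cN = combinatorial_map_N
  have U: "vertex N d = {p, a0, a1, a2}" if "d \<in> {p, a0, a1, a2}" for d
    using vertex_eq[OF cN, of d p] that vertex_N_p by simp
  have W: "vertex N d = {q, a3, a4, a5}" if "d \<in> {q, a3, a4, a5}" for d
    using vertex_eq[OF cN, of d q] that vertex_N_q by simp
  have "v \<union> (darts M - v) = darts M" using v_darts by (simp only: Un_Diff_cancel Un_absorb1)
  then have "darts N = insert p (insert q (v \<union> (darts M - v)))" by (simp only: darts_N)
  also have "\<dots> = {p, a0, a1, a2} \<union> {q, a3, a4, a5} \<union> (darts M - v)"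
    by (simp only: Un_insert_left Un_empty_left insert_commute)
  finally have "vertices N = vertex N ` {p, a0, a1, a2} \<union> vertex N ` {q, a3, a4, a5} \<union> vertex N ` (darts M - v)"
    unfolding vertices_def by (simp only: image_Un)
  moreover have "vertex N ` {p, a0, a1, a2} = {{p, a0, a1, a2}}"  by (rule image_eq_singleton[OF _ U]) simp
  moreover have "vertex N ` {q, a3, a4, a5} = {{q, a3, a4, a5}}"  by (rule image_eq_singleton[OF _ W]) simp
  moreover have "vertex N ` (darts M - v) = vertices M - {v}"
  proof -
    have "v \<notin> vertex M ` (darts M - v)"
    proof
      assume "v \<in> vertex M ` (darts M - v)"
      then obtain d where "v = vertex M d" "d \<notin> v" by blast
      then show False using in_vertex[OF M, of d] by simp
    qed
    moreover have "vertex M ` darts M = vertex M ` (darts M - v) \<union> {v}"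
    proof -
      have "vertex M ` v = {v}" by (rule image_eq_singleton[OF _ vertex_v]) simp
      moreover have "darts M = (darts M - v) \<union> v" using v_darts by (simp only: Un_Diff_cancel2 Un_absorb2)
      then have "vertex M ` darts M = vertex M ` (darts M - v) \<union> vertex M ` v" by (metis image_Un)
      ultimately show ?thesis by simp
    qed
    ultimately have "vertex M ` (darts M - v) = vertices M - {v}"
      unfolding vertices_def by simp
    moreover have "vertex N ` (darts M - v) = vertex M ` (darts M - v)"
      by (rule image_cong[OF refl]) (rule vertex_N_old)
    ultimately show ?thesis by simp
  qed
  ultimately show ?thesis by (simp only: Un_insert_left Un_empty_left insert_commute)
qed

lemma v_vertex: "v \<in> vertices M"
  unfolding vertices_def using vertex_v[of a0] a0_in by (metis imageI insertI1)

lemma finite_vertices: "finite (vertices M)"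
  using finite_darts[OF M] by (simp add: vertices_def)

lemma new_vertices_notin: "{p, a0, a1, a2} \<notin> vertices M" "{q, a3, a4, a5} \<notin> vertices M"
proof -
  have "w \<subseteq> darts M" if "w \<in> vertices M" for w
    using that vertex_subset[OF M] by (auto simp: vertices_def)
  then show "{p, a0, a1, a2} \<notin> vertices M" "{q, a3, a4, a5} \<notin> vertices M"
    using pq(1,2) by (metis insertI1 subsetD)+
qed

lemma new_vertices_neq: "{p, a0, a1, a2} \<noteq> {q, a3, a4, a5}"
proof -
  have "p \<notin> {q, a3, a4, a5}" using pq(3) a_neq_pq by blast
  then show ?thesis by blast
qed

lemma card_vertices_N: "card (vertices N) = card (vertices M) + 1"
proof -
  have "card (vertices N) = Suc (Suc (card (vertices M - {v})))"
    unfolding vertices_N using finite_vertices new_vertices_notin new_vertices_neq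
    by (intro card_insert_two) (simp_all only: finite_Diff Diff_iff simp_thms)
  then show ?thesis using card.remove[OF finite_vertices v_vertex] by simp
qed

lemma edges_N: "edges N = insert {p, q} (edges M)"
proof -
  have "(\<lambda>d. {d, opp N d}) ` darts M = edges M"
    unfolding edges_def by (rule image_cong) (simp_all add: opp_N_old)
  then show ?thesis by (simp add: edges_def darts_N opp_N insert_commute)
qed

lemma new_edge_notin: "{p, q} \<notin> edges M"
  using edges_subset[OF M, of "{p, q}"] pq(1) by blast

lemma card_edges_N: "card (edges N) = card (edges M) + 1"
proof -
  have "finite (edges M)" using finite_darts[OF M] by (simp add: edges_def)
  then show ?thesis using new_edge_notin by (simp add: edges_N)
qed

text \<open>
  The new edge subdivides no face: it only adds \<open>p\<close> before \<open>a3\<close> and \<open>q\<close> before \<open>a0\<close> on the boundary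
  of the faces in which these gaps lie.
\<close>

lemma face_N_old:
  assumes d: "d \<in> darts M" shows "face N d \<inter> darts M = face M d"
  unfolding face_def
proof (rule orbit_Int_detour[OF _ _ d])
  fix x assume x: "x \<in> darts M"
  then have o: "opp M x \<in> darts M" "opp N x = opp M x" by (simp_all add: opp_in_iff[OF M] opp_N_old)
  then show "(rot M \<circ> opp M) x \<in> darts M" by (simp add: rot_in_iff[OF M])
  consider "opp M x = a2" | "opp M x = a5" | "opp M x \<noteq> a2" "opp M x \<noteq> a5" by blast
  then show "(rot N \<circ> opp N) x = (rot M \<circ> opp M) x \<or>
    (rot N \<circ> opp N) x \<notin> darts M \<and> (rot N \<circ> opp N) ((rot N \<circ> opp N) x) = (rot M \<circ> opp M) x"
  proof cases
    case 3
    then show ?thesis using o not_pq[OF o(1)] by (simp add: rot_N_other)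
  qed (simp_all add: o rots rot_N opp_N pq)
qed

lemma faces_N: "faces N = face N ` darts M"
proof -
  note cN = combinatorial_map_N
  have "face N p = face N a3"
    by (rule face_eq[OF cN, symmetric]) (simp add: face_def orbit_eqI opp_N rot_N)
  moreover have "face N q = face N a0"
    by (rule face_eq[OF cN, symmetric]) (simp add: face_def orbit_eqI opp_N rot_N)
  ultimately show ?thesis unfolding faces_def darts_N using a_in(1,4) by blast
qed

lemma card_faces_N: "card (faces N) = card (faces M)"
proof -
  have "inj_on (\<lambda>F. F \<inter> darts M) (faces N)"
  proof (rule inj_onI)
    fix F G assume F: "F \<in> faces N" and G: "G \<in> faces N" and eq: "F \<inter> darts M = G \<inter> darts M"
    obtain d where d: "d \<in> darts M" "F = face N d" using F unfolding faces_N by blast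
    then have "d \<in> G" using eq in_face[OF combinatorial_map_N, of d] by blast
    then show "F = G" using d(2) mem_face_iff[OF combinatorial_map_N G] by blast
  qed
  moreover have "(\<lambda>F. F \<inter> darts M) ` faces N = faces M"
    unfolding faces_N image_image unfolding faces_def by (rule image_cong) (simp_all add: face_N_old)
  ultimately show ?thesis using card_image by metis
qed

text \<open>
  A small cut that does not separate the two new vertices is a cut of the original graph; one that
  does is an obstruction.
\<close>

lemma four_edge_connected_N:
  assumes fc: "four_edge_connected M" and ev: "even_vertices N"
    and free: "\<nexists>T. obstruction M v {a0, a1, a2} T"
  shows "four_edge_connected N"
  unfolding four_edge_connected_def
proof (intro allI impI, rule ccontr)
  note cN = combinatorial_map_N
  \<comment> \<open>if the cut separates the new vertices, let \<open>X\<close> be the side of \<open>p\<close>\<close>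
  have key: False
    if X: "vertex_union N X" "X \<noteq> {}" "X \<noteq> darts N" "card (out_darts N X) < 4" and p: "p \<in> X \<or> q \<notin> X" for X
  proof -
    have XN: "X \<subseteq> darts N" using X(1) by (simp add: vertex_union_def)
    let ?T = "X \<inter> darts M"
    have finX: "finite (out_darts N X)" by (rule finite_out_darts[OF cN XN])
    have old: "d \<in> out_darts N X \<longleftrightarrow> d \<in> out_darts M ?T" if "d \<in> darts M" for d
      using that opp_in_iff[OF M, of d] by (simp add: out_darts_def opp_N_old)
    have out_sub: "out_darts M ?T \<subseteq> out_darts N X"
      using old by (auto simp: out_darts_def)
    have rotX: "rot N d \<in> X \<longleftrightarrow> d \<in> X" for d by (rule vertex_union_rot_iff[OF cN X(1)])
    have memp: "a0 \<in> X \<longleftrightarrow> p \<in> X" "a1 \<in> X \<longleftrightarrow> p \<in> X" "a2 \<in> X \<longleftrightarrow> p \<in> X"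
      using rotX[of p] rotX[of a0] rotX[of a1] rot_N by simp_all
    have memq: "a3 \<in> X \<longleftrightarrow> q \<in> X" "a4 \<in> X \<longleftrightarrow> q \<in> X" "a5 \<in> X \<longleftrightarrow> q \<in> X"
      using rotX[of q] rotX[of a3] rotX[of a4] rot_N by simp_all
    have rotT: "rot M d \<in> ?T \<longleftrightarrow> d \<in> ?T" if "d \<in> darts M - v" for d
      using rotX[of d] rot_N_other[of d] that not_pq[of d] rot_in_iff[OF M, of d] by simp
    show False
    proof (cases "p \<in> X \<longleftrightarrow> q \<in> X")
      case True
      have "vertex_union M ?T"
        unfolding vertex_union_def
      proof (intro conjI ballI)
        fix d assume d: "d \<in> ?T"
        show "rot M d \<in> ?T"
        proof (cases "d \<in> v")
          case True
          then have "rot M d \<in> v" using vertex_union_rot_iff[OF M vertex_union_v] by blast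
          moreover have "x \<in> X \<longleftrightarrow> p \<in> X" if "x \<in> v" for x
            using that memp memq \<open>p \<in> X \<longleftrightarrow> q \<in> X\<close> by blast
          ultimately show ?thesis using d True v_darts by blast
        next
          case False
          then show ?thesis using rotT[of d] d by blast
        qed
      qed blast
      moreover have "card (out_darts M ?T) < 4"
        using card_mono[OF finX out_sub] X(4) by simp
      ultimately have T: "?T = {} \<or> ?T = darts M" by (rule four_edge_connectedD[OF fc])
      have "a0 \<in> ?T \<longleftrightarrow> p \<in> X" using memp(1) a0_in by blast
      then show False using T True X(2,3) XN a0_in unfolding darts_N by blast
    next
      case False
      then have pX: "p \<in> X" "q \<notin> X" using p by blast+
      have "even (card (out_darts N X))"
        using even_out_darts[OF cN _ X(1)] ev by (simp add: even_vertices_def)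
      then have "card (out_darts N X) \<le> 2" using X(4) by presburger
      moreover have "p \<in> out_darts N X" using pX by (simp add: out_darts_def opp_N)
      moreover have "p \<notin> out_darts M ?T" using pq(1) by (simp add: out_darts_def)
      then have "out_darts M ?T \<subseteq> out_darts N X - {p}" using out_sub by blast
      then have "card (out_darts M ?T) \<le> card (out_darts N X - {p})" using finX by (intro card_mono) simp_all
      ultimately have "card (out_darts M ?T) \<le> 1" using finX by simp
      moreover have "?T \<inter> v = {a0, a1, a2}" using pX memp memq v_darts by blast
      ultimately have "obstruction M v {a0, a1, a2} ?T"
        using rotT unfolding obstruction_def by blast
      then show False using free by blast
    qed
  qed
  fix X assume X: "vertex_union N X \<and> X \<noteq> {} \<and> X \<noteq> darts N" and "\<not> 4 \<le> card (out_darts N X)"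
  then have small: "card (out_darts N X) < 4" by simp
  have XN: "X \<subseteq> darts N" using X by (simp add: vertex_union_def)
  show False
  proof (cases "p \<in> X \<or> q \<notin> X")
    case True
    then show False using key X small by blast
  next
    case False
    then have "p \<in> darts N - X" by (simp add: darts_N)
    moreover have "vertex_union N (darts N - X)"
      using vertex_union_diff[OF cN vertex_union_darts[OF cN]] X by blast
    moreover have "card (out_darts N (darts N - X)) < 4"
      using card_out_darts_complement[OF cN XN] small by simp
    moreover have "darts N - X \<noteq> {}" "darts N - X \<noteq> darts N" using X XN by blast+
    ultimately show False using key by blast
  qed
qed


end

section \<open>Splitting all 6-valent vertices\<close>


lemma four_edge_connected_imp_connected:
  assumes M: "combinatorial_map M" and fc: "four_edge_connected M"
  shows "connected_map M"
  unfolding connected_map_def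
proof (intro ballI)
  fix d d' assume d: "d \<in> darts M" and d': "d' \<in> darts M"
  let ?R = "{x. (d, x) \<in> (step_rel M)\<^sup>*}"
  have sub: "x \<in> darts M" if "(d, x) \<in> (step_rel M)\<^sup>*" for x
    using that by induction (use d rot_in_iff[OF M] opp_in_iff[OF M] in \<open>auto simp: step_rel_def\<close>)
  have rot: "(d, rot M x) \<in> (step_rel M)\<^sup>*" and opp: "(d, opp M x) \<in> (step_rel M)\<^sup>*"
    if "(d, x) \<in> (step_rel M)\<^sup>*" for x
    using that sub[OF that] by (auto simp: step_rel_def intro: rtrancl_into_rtrancl)
  have "vertex_union M ?R" using sub rot by (simp add: vertex_union_def subset_iff)
  moreover have "out_darts M ?R = {}" using opp by (simp add: out_darts_def)
  then have "card (out_darts M ?R) < 4" by simp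
  ultimately have "?R = {} \<or> ?R = darts M" by (rule four_edge_connectedD[OF fc])
  then have "?R = darts M" by blast
  then show "(d, d') \<in> (step_rel M)\<^sup>*" using d' by blast
qed

lemma vertex_neq_darts:
  assumes M: "combinatorial_map M" and v: "v \<in> vertices M" and many: "1 < card (vertices M)"
  shows "v \<noteq> darts M"
proof
  assume "v = darts M"
  then have "vertex M d = v" if "d \<in> darts M" for d
    using mem_vertex_iff[OF M v, of d] that by simp
  then have "vertices M \<subseteq> {v}" by (auto simp: vertices_def)
  then have "card (vertices M) \<le> 1" using card_mono[of "{v}"] by simp
  then show False using many by simp
qed

text \<open>
  A 4-valent vertex with a loop has at most two further edges.
\<close>

lemma four_edge_connected_imp_loopless:
  assumes M: "combinatorial_map M" and fc: "four_edge_connected M" and reg: "regular_map 4 M"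
    and many: "1 < card (vertices M)"
  shows "loopless M"
  unfolding loopless_def
proof (intro ballI notI)
  fix d assume d: "d \<in> darts M" and loop: "opp M d \<in> vertex M d"
  let ?v = "vertex M d"
  have v: "?v \<in> vertices M" using d by (simp add: vertices_def)
  have fin: "finite ?v" using finite_subset[OF vertex_subset[OF M d] finite_darts[OF M]] .
  have dv: "d \<in> ?v" by (rule in_vertex[OF M])
  have "opp M d \<notin> out_darts M ?v" "d \<notin> out_darts M ?v"
    using loop dv opp_opp[OF M d] by (simp_all add: out_darts_def)
  then have "out_darts M ?v \<subseteq> ?v - {d}" unfolding out_darts_def by blast
  then have "card (out_darts M ?v) \<le> card (?v - {d})" using fin by (intro card_mono) simp_all
  also have "\<dots> < 4" using reg v dv fin by (simp add: regular_map_def)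
  finally have "?v = {} \<or> ?v = darts M"
    by (rule four_edge_connectedD[OF fc vertex_union_vertex[OF M d]])
  then show False using dv vertex_neq_darts[OF M v many] by blast
qed

context vertex_split
begin

lemma connected_sphere_map_N:
  assumes "connected_sphere_map M" "four_edge_connected N"
  shows "connected_sphere_map N"
  using assms(1) combinatorial_map_N four_edge_connected_imp_connected[OF combinatorial_map_N assms(2)]
  by (simp add: connected_sphere_map_def card_vertices_N card_edges_N card_faces_N darts_N)

lemma card_new_vertices: "card {p, a0, a1, a2} = 4" "card {q, a3, a4, a5} = 4"
  using dist a_neq_pq[symmetric] by simp_all

lemma card_v: "card v = 6"
  using dist by simp

lemma degrees_N:
  assumes "\<And>w. w \<in> vertices M \<Longrightarrow> card w = 4 \<or> card w = 6" and "w \<in> vertices N"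
  shows "card w = 4 \<or> card w = 6"
proof -
  consider "w = {p, a0, a1, a2}" | "w = {q, a3, a4, a5}" | "w \<in> vertices M"
    using assms(2) unfolding vertices_N by blast
  then show ?thesis
  proof cases
    case 1 then show ?thesis using card_new_vertices(1) by simp
  next
    case 2 then show ?thesis using card_new_vertices(2) by simp
  qed (rule assms(1))
qed

lemma six_valent_vertices_N:
  "{w \<in> vertices N. card w = 6} = {w \<in> vertices M. card w = 6} - {v}"
proof -
  have "{w \<in> {{p, a0, a1, a2}, {q, a3, a4, a5}}. card w = 6} = {}" using card_new_vertices by auto
  then show ?thesis unfolding vertices_N by blast
qed

lemma old_edge:
  assumes E: "E \<subseteq> edges M" and y: "y \<in> \<Union>E"
  shows "y \<in> darts M" "opp M y \<in> \<Union>E"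
proof -
  obtain e where e: "e \<in> E" "y \<in> e" using y by blast
  then obtain z where z: "z \<in> darts M" "e = {z, opp M z}" using E unfolding edges_def by blast
  then have "y = z \<or> y = opp M z" using e(2) by blast
  then show "y \<in> darts M" "opp M y \<in> \<Union>E"
    using z e(1) opp_in_iff[OF M, of z] opp_opp[OF M z(1)] by auto
qed

text \<open>
  Contracting the new edge undoes the splitting, also when other edges are contracted at the same
  time, as long as these do not touch the split vertex.
\<close>

lemma contract_N:
  assumes E: "E \<subseteq> edges M" and v: "\<Union>E \<inter> v = {}"
  shows "contract N (insert {p, q} E) = contract M E"
proof -
  let ?D = "darts M - \<Union>E" and ?E = "insert {p, q} E"
  have D: "darts N - \<Union>?E = ?D" using pq by (auto simp: darts_N)
  have mem: "y \<in> \<Union>?E \<longleftrightarrow> y \<in> \<Union>E" if "y \<in> darts M" for y using not_pq[OF that] by blast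
  have pE: "p \<in> \<Union>?E" "q \<in> \<Union>?E" by blast+
  have aE: "a0 \<notin> \<Union>E" "a3 \<notin> \<Union>E" using v by blast+
  have rot: "(if rot N x \<in> \<Union>?E then rot N (opp N (rot N x)) else rot N x)
    = (if rot M x \<in> \<Union>E then rot M (opp M (rot M x)) else rot M x)" if x: "x \<in> ?D" for x
  proof -
    consider "x = a2" | "x = a5" | "x \<noteq> a2" "x \<noteq> a5" by blast
    then show ?thesis
    proof cases
      case 1
      then show ?thesis using pE aE by (simp add: rot_N opp_N rots del: Union_iff Union_insert)
    next
      case 2
      then show ?thesis using pE aE by (simp add: rot_N opp_N rots del: Union_iff Union_insert)
    next
      case 3
      have xM: "x \<in> darts M" using x by blast
      then have r: "rot N x = rot M x" "rot M x \<in> darts M"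
        using 3 not_pq[OF xM] rot_in_iff[OF M] by (simp_all add: rot_N_other)
      show ?thesis
      proof (cases "rot M x \<in> \<Union>E")
        case True
        then have o: "opp M (rot M x) \<in> \<Union>E" by (rule old_edge(2)[OF E])
        then have "opp M (rot M x) \<in> darts M" "opp M (rot M x) \<notin> v" using old_edge(1)[OF E] v by blast+
        then have "rot N (opp N (rot M x)) = rot M (opp M (rot M x))"
          using not_pq opp_N_old[OF r(2)] by (metis insertCI rot_N_other)
        then show ?thesis unfolding r(1) mem[OF r(2)] by argo
      next
        case False
        then show ?thesis unfolding r(1) mem[OF r(2)] by argo
      qed
    qed
  qed
  have opp: "opp N x = opp M x" if "x \<in> ?D" for x using that by (simp add: opp_N_old)
  show ?thesis unfolding contract_def D
    by (intro arg_cong3[where f = "\<lambda>d r s. \<lparr>darts = d, rot = r, opp = s\<rparr>"] refl ext)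
      (use rot opp in presburger)+
qed

lemma edge_ends_N:
  assumes "e \<in> E" "E \<subseteq> edges M" "\<Union>E \<inter> v = {}"
  shows "edge_ends N e = edge_ends M e"
  unfolding edge_ends_def
proof (rule image_cong[OF refl])
  fix d assume "d \<in> e"
  then have "d \<in> \<Union>E" using assms(1) by blast
  then have "d \<in> darts M - v" using old_edge(1)[OF assms(2)] assms(3) by blast
  then show "vertex N d = vertex M d" by (rule vertex_N_old)
qed

lemma pairwise_vertex_disjoint_N:
  assumes E: "E \<subseteq> edges M" "\<Union>E \<inter> v = {}" and disj: "pairwise_vertex_disjoint M E"
  shows "pairwise_vertex_disjoint N (insert {p, q} E)"
proof -
  have new: "edge_ends N {p, q} = {{p, a0, a1, a2}, {q, a3, a4, a5}}"
    by (simp add: edge_ends_def vertex_N_p vertex_N_q)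
  have cross: "edge_ends N {p, q} \<inter> edge_ends N e = {}" if e: "e \<in> E" for e
  proof -
    have "edge_ends M e \<subseteq> vertices M"
      using e E(1) opp_in_iff[OF M] by (auto simp: edge_ends_def vertices_def edges_def)
    then show ?thesis unfolding new edge_ends_N[OF e E] using new_vertices_notin by blast
  qed
  show ?thesis unfolding pairwise_vertex_disjoint_def
  proof (intro ballI impI)
    fix e e' assume e: "e \<in> insert {p, q} E" "e' \<in> insert {p, q} E" "e \<noteq> e'"
    consider "e = {p, q}" "e' \<in> E" | "e \<in> E" "e' = {p, q}" | "e \<in> E" "e' \<in> E" using e by blast
    then show "edge_ends N e \<inter> edge_ends N e' = {}"
    proof cases
      case 1 then show ?thesis using cross[of e'] by simp
    next
      case 2 then show ?thesis using cross[of e] by (simp add: Int_commute)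
    next
      case 3
      then show ?thesis using disj e(3) edge_ends_N[OF _ E]
        unfolding pairwise_vertex_disjoint_def by metis
    qed
  qed
qed

end

text \<open>
  The three ways of splitting a vertex are the same splitting for three choices of its first dart.
\<close>

lemma nonobstructed_split:
  assumes M: "combinatorial_map M" and fc: "four_edge_connected M" and many: "1 < card (vertices M)"
    and v: "v \<in> vertices M" "card v = 6"
  obtains a0 a1 a2 a3 a4 a5 where "six_valent M a0 a1 a2 a3 a4 a5" "v = {a0, a1, a2, a3, a4, a5}"
    "\<nexists>T. obstruction M v {a0, a1, a2} T"
proof -
  obtain a0 where a0: "a0 \<in> darts M" "v = vertex M a0" using v(1) by (auto simp: vertices_def)
  obtain a1 a2 a3 a4 a5 where six: "six_valent M a0 a1 a2 a3 a4 a5" and vs: "v = {a0, a1, a2, a3, a4, a5}"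
    using six_valent_vertex[OF M a0(1)] v(2) a0(2) by metis
  interpret six_valent M a0 a1 a2 a3 a4 a5 by (rule six)
  interpret r1: six_valent M a1 a2 a3 a4 a5 a0 by (rule rotated)
  have six2: "six_valent M a2 a3 a4 a5 a0 a1" by (rule r1.rotated)
  have vs1: "v = {a1, a2, a3, a4, a5, a0}" and vs2: "v = {a2, a3, a4, a5, a0, a1}"
    unfolding vs by (simp_all only: insert_commute)
  have "v \<noteq> darts M" by (rule vertex_neq_darts[OF M v(1) many])
  then have "(\<nexists>T. obstruction M v {a0, a1, a2} T) \<or> (\<nexists>T. obstruction M v {a1, a2, a3} T)
      \<or> (\<nexists>T. obstruction M v {a2, a3, a4} T)"
    using one_of_three_splits[OF fc] unfolding vs by metis
  then show thesis
    using that[OF six vs] that[OF rotated vs1] that[OF six2 vs2] by argo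
qed

text \<open>
  The edges \<open>E\<close> created so far join 4-valent vertices, which later splittings leave alone.  The
  labels are natural numbers because every splitting needs two new ones.
\<close>

lemma split_all_six_valent:
  fixes M :: "nat cmap"
  assumes "connected_sphere_map M" "four_edge_connected M"
    and "\<And>v. v \<in> vertices M \<Longrightarrow> card v = 4 \<or> card v = 6" and "1 < card (vertices M)"
    and "E \<subseteq> edges M" "pairwise_vertex_disjoint M E"
    and "\<And>d. d \<in> \<Union>E \<Longrightarrow> card (vertex M d) = 4"
    and "card {v \<in> vertices M. card v = 6} = k"
  shows "\<exists>S E'. connected_sphere_map S \<and> four_edge_connected S \<and> regular_map 4 S \<and>
    card (vertices S) = card (vertices M) + k \<and> E' \<subseteq> edges S \<and> card E' = card E + k \<and>
    pairwise_vertex_disjoint S E' \<and> contract S E' = contract M E"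
  using assms
proof (induction k arbitrary: M E)
  case 0
  have "finite {v \<in> vertices M. card v = 6}"
    using 0(1) finite_darts[of M] by (simp add: vertices_def connected_sphere_map_def)
  then have "{v \<in> vertices M. card v = 6} = {}" using 0(8) by simp
  then have "regular_map 4 M" using 0(3) unfolding regular_map_def by blast
  then show ?case using 0(1,2,4,5,6) by (intro exI[of _ M] exI[of _ E]) simp
next
  case (Suc k)
  note sphere = Suc.prems(1) and fc = Suc.prems(2) and deg = Suc.prems(3) and many = Suc.prems(4)
    and E = Suc.prems(5) and disj = Suc.prems(6) and degE = Suc.prems(7) and count = Suc.prems(8)
  have M: "combinatorial_map M" using sphere by (simp add: connected_sphere_map_def)
  have "{v \<in> vertices M. card v = 6} \<noteq> {}" using count by (metis card.empty nat.distinct(1))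
  then obtain v where v: "v \<in> vertices M" "card v = 6" by blast
  obtain a0 a1 a2 a3 a4 a5 where six: "six_valent M a0 a1 a2 a3 a4 a5"
    and vs: "v = {a0, a1, a2, a3, a4, a5}" and free: "\<nexists>T. obstruction M v {a0, a1, a2} T"
    by (rule nonobstructed_split[OF M fc many v])
  obtain p where p: "p \<notin> darts M"
    using ex_new_if_finite[OF infinite_UNIV_nat finite_darts[OF M]] by blast
  obtain q where q: "q \<notin> insert p (darts M)"
    using ex_new_if_finite[OF infinite_UNIV_nat, of "insert p (darts M)"] finite_darts[OF M] by blast
  interpret vertex_split M a0 a1 a2 a3 a4 a5 p q
    using six p q by (intro vertex_split.intro vertex_split_axioms.intro) auto
  let ?E = "insert {p, q} E"
  have degN: "card w = 4 \<or> card w = 6" if "w \<in> vertices N" for w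
    by (rule degrees_N[OF deg that])
  have "even (card w)" if "w \<in> vertices N" for w using degN[OF that] by auto
  then have ev: "even_vertices N" by (simp add: even_vertices_def)
  have fcN: "four_edge_connected N"
    by (rule four_edge_connected_N[OF fc ev free[unfolded vs]])
  have Ev: "\<Union>E \<inter> {a0, a1, a2, a3, a4, a5} = {}"
  proof -
    have "d \<notin> {a0, a1, a2, a3, a4, a5}" if "d \<in> \<Union>E" for d
    proof
      assume "d \<in> {a0, a1, a2, a3, a4, a5}"
      then have "card (vertex M d) = 6" using card_v by (simp only: vertex_v)
      then show False using degE[OF that] by simp
    qed
    then show ?thesis by blast
  qed
  have "\<exists>S E'. connected_sphere_map S \<and> four_edge_connected S \<and> regular_map 4 S \<and>
    card (vertices S) = card (vertices N) + k \<and> E' \<subseteq> edges S \<and> card E' = card ?E + k \<and>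
    pairwise_vertex_disjoint S E' \<and> contract S E' = contract N ?E"
  proof (rule Suc.IH)
    show "connected_sphere_map N" by (rule connected_sphere_map_N[OF sphere fcN])
    show "1 < card (vertices N)" using many by (simp add: card_vertices_N)
    show "?E \<subseteq> edges N" using E unfolding edges_N by blast
    show "pairwise_vertex_disjoint N ?E" by (rule pairwise_vertex_disjoint_N[OF E Ev disj])
    show "card (vertex N d) = 4" if d: "d \<in> \<Union>?E" for d
    proof -
      consider "d = p" | "d = q" | "d \<in> \<Union>E" using d by blast
      then show ?thesis
      proof cases
        case 3
        then have "d \<in> darts M - {a0, a1, a2, a3, a4, a5}" using old_edge(1)[OF E] Ev by blast
        then show ?thesis using degE[OF 3] by (simp only: vertex_N_old)
      qed (simp_all only: vertex_N_p vertex_N_q card_new_vertices)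
    qed
    show "card {w \<in> vertices N. card w = 6} = k"
      unfolding six_valent_vertices_N
    proof -
      have "finite {w \<in> vertices M. card w = 6}" "v \<in> {w \<in> vertices M. card w = 6}"
        using finite_vertices v by simp_all
      then show "card ({w \<in> vertices M. card w = 6} - {{a0, a1, a2, a3, a4, a5}}) = k"
        using count unfolding vs by (metis card_Diff_singleton diff_Suc_1)
    qed
  qed (fact fcN degN)+
  moreover have "card ?E = card E + 1"
  proof -
    have "{p, q} \<notin> E" using E new_edge_notin by blast
    moreover have "finite E"
      by (rule finite_subset[OF E]) (simp add: edges_def finite_darts[OF M])
    ultimately show ?thesis by simp
  qed
  ultimately show ?case
    unfolding contract_N[OF E Ev] card_vertices_N by (simp only: add.assoc plus_1_eq_Suc)
qed

section \<open>Relabelling and the theorem\<close>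


definition relabel :: "('a \<Rightarrow> 'b) \<Rightarrow> 'a cmap \<Rightarrow> 'b cmap" where
  "relabel f M =
     \<lparr>darts = f ` darts M,
      rot = (\<lambda>x. if x \<in> f ` darts M then f (rot M (inv_into (darts M) f x)) else x),
      opp = (\<lambda>x. if x \<in> f ` darts M then f (opp M (inv_into (darts M) f x)) else x)\<rparr>"

locale relabelling =
  fixes M :: "'a cmap" and f :: "'a \<Rightarrow> 'b"
  assumes M: "combinatorial_map M" and inj: "inj_on f (darts M)"
begin

abbreviation "R \<equiv> relabel f M"

lemma darts_R: "darts R = f ` darts M"
  by (simp add: relabel_def)

lemma rot_R: "d \<in> darts M \<Longrightarrow> rot R (f d) = f (rot M d)"
  and opp_R: "d \<in> darts M \<Longrightarrow> opp R (f d) = f (opp M d)"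
  by (simp_all add: relabel_def inv_into_f_f[OF inj])

lemma combinatorial_map_R: "combinatorial_map R"
  unfolding combinatorial_map_def
proof (intro conjI)
  have bij: "bij_betw f (darts M) (f ` darts M)" using inj by (rule inj_on_imp_bij_betw)
  show "finite (darts R)" using finite_darts[OF M] by (simp add: darts_R)
  show "rot R permutes darts R"
    using permutes_bij_inv_into[OF rot_permutes[OF M] bij] by (simp add: relabel_def)
  show "opp R permutes darts R"
    using permutes_bij_inv_into[OF opp_permutes[OF M] bij] by (simp add: relabel_def)
  show "\<forall>x\<in>darts R. opp R x \<noteq> x \<and> opp R (opp R x) = x"
  proof
    fix x assume "x \<in> darts R"
    then obtain d where d: "d \<in> darts M" "x = f d" unfolding darts_R by blast
    have o: "opp M d \<in> darts M" using d(1) opp_in_iff[OF M] by blast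
    then have "f (opp M d) \<noteq> f d" using opp_neq[OF M d(1)] inj_on_eq_iff[OF inj o d(1)] by blast
    then show "opp R x \<noteq> x \<and> opp R (opp R x) = x"
      using d o by (simp add: opp_R opp_opp[OF M])
  qed
qed

lemma vertex_R:
  assumes d: "d \<in> darts M" shows "vertex R (f d) = f ` vertex M d"
  unfolding vertex_def
proof (rule orbit_inverse[symmetric])
  show "d \<in> orbit (rot M) d" using in_vertex[OF M] by (simp add: vertex_def)
  show "rot R (f x) = f (rot M x)" if "x \<in> orbit (rot M) d" for x
    using that vertex_subset[OF M d] by (intro rot_R) (auto simp: vertex_def)
qed

lemma face_R:
  assumes d: "d \<in> darts M" shows "face R (f d) = f ` face M d"
  unfolding face_def
proof (rule orbit_inverse[symmetric])
  show "d \<in> orbit (rot M \<circ> opp M) d" using in_face[OF M] by (simp add: face_def)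
  fix x assume "x \<in> orbit (rot M \<circ> opp M) d"
  then have "x \<in> darts M" using face_subset[OF M d] by (auto simp: face_def)
  then show "(rot R \<circ> opp R) (f x) = f ((rot M \<circ> opp M) x)"
    by (simp add: opp_R rot_R opp_in_iff[OF M])
qed

lemma vertices_R: "vertices R = image f ` vertices M"
  unfolding vertices_def darts_R image_image by (rule image_cong[OF refl]) (rule vertex_R)

lemma faces_R: "faces R = image f ` faces M"
  unfolding faces_def darts_R image_image by (rule image_cong[OF refl]) (rule face_R)

lemma edges_R: "edges R = image f ` edges M"
  unfolding edges_def darts_R image_image by (rule image_cong[OF refl]) (simp add: opp_R)

lemma card_image_R:
  assumes "A \<subseteq> Pow (darts M)" shows "card (image f ` A) = card A"
  by (rule card_image) (rule inj_on_subset[OF inj_on_image_Pow[OF inj] assms])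

lemma subset_Pow_darts: "vertices M \<subseteq> Pow (darts M)" "faces M \<subseteq> Pow (darts M)" "edges M \<subseteq> Pow (darts M)"
  using vertex_subset[OF M] face_subset[OF M] opp_in_iff[OF M]
  by (auto simp: vertices_def faces_def edges_def)

lemma connected_sphere_map_R:
  assumes S: "connected_sphere_map M" shows "connected_sphere_map R"
  unfolding connected_sphere_map_def
proof (intro conjI)
  show "darts R \<noteq> {}" using S by (simp add: connected_sphere_map_def darts_R)
  show "card (vertices R) + card (faces R) = card (edges R) + 2"
    using S by (simp add: connected_sphere_map_def vertices_R faces_R edges_R card_image_R subset_Pow_darts)
  show "connected_map R" unfolding connected_map_def darts_R
  proof (intro ballI)
    fix x y assume "x \<in> f ` darts M" "y \<in> f ` darts M"
    then obtain d e where d: "d \<in> darts M" "x = f d" and e: "e \<in> darts M" "y = f e" by blast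
    have "(d, e) \<in> (step_rel M)\<^sup>*" using S d e by (simp add: connected_sphere_map_def connected_map_def)
    then have "(f d, f e) \<in> (step_rel R)\<^sup>*"
    proof induction
      case (step a b)
      then have a: "a \<in> darts M" and "b = rot M a \<or> b = opp M a" by (auto simp: step_rel_def)
      then have "f b = rot R (f a) \<or> f b = opp R (f a)" using rot_R[OF a] opp_R[OF a] by metis
      moreover have "f a \<in> darts R" using a by (simp add: darts_R)
      ultimately have "(f a, f b) \<in> step_rel R" unfolding step_rel_def by blast
      then show ?case using step.IH by (rule rtrancl_into_rtrancl[rotated])
    qed simp
    then show "(x, y) \<in> (step_rel R)\<^sup>*" using d e by simp
  qed
qed (rule combinatorial_map_R)

lemma regular_map_R:
  assumes "regular_map k M" shows "regular_map k R"
  unfolding regular_map_def vertices_R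
proof
  fix w assume "w \<in> image f ` vertices M"
  then obtain v where v: "v \<in> vertices M" "w = f ` v" by blast
  then have "inj_on f v" using subset_Pow_darts(1) by (intro inj_on_subset[OF inj]) blast
  then show "card w = k" using v assms by (simp add: card_image regular_map_def)
qed

lemma prime_map_R:
  assumes prime: "prime_map M" shows "prime_map R"
  unfolding prime_map_def
proof (intro allI impI)
  fix x y assume c: "two_point_circle R x y"
  then obtain d e where d: "d \<in> darts M" "x = f d" and e: "e \<in> darts M" "y = f e"
    unfolding two_point_circle_def darts_R by blast
  have face_eq_iff: "face R (f a) = face R (f b) \<longleftrightarrow> face M a = face M b" if "a \<in> darts M" "b \<in> darts M" for a b
    using that by (simp add: face_R inj_on_image_eq_iff[OF inj] face_subset[OF M])
  have "two_point_circle M d e"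
    using c d e by (simp add: two_point_circle_def opp_R face_eq_iff opp_in_iff[OF M])
  then have "e = opp M d" using prime unfolding prime_map_def by blast
  then show "y = opp R x" using d e by (simp add: opp_R)
qed

lemma cmap_iso_R: "cmap_iso R M"
  unfolding cmap_iso_def
proof (intro exI conjI ballI)
  show "bij_betw (inv_into (darts M) f) (darts R) (darts M)"
    unfolding darts_R by (rule bij_betw_inv_into) (rule inj_on_imp_bij_betw[OF inj])
  fix x assume "x \<in> darts R"
  then obtain d where d: "d \<in> darts M" "x = f d" unfolding darts_R by blast
  then show "inv_into (darts M) f (rot R x) = rot M (inv_into (darts M) f x)"
    "inv_into (darts M) f (opp R x) = opp M (inv_into (darts M) f x)"
    by (simp_all add: rot_R opp_R inv_into_f_f[OF inj] rot_in_iff[OF M] opp_in_iff[OF M])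
qed

end

lemma contract_empty:
  assumes M: "combinatorial_map M" shows "contract M {} = M"
proof -
  have "rot M x = x" "opp M x = x" if "x \<notin> darts M" for x
    using that permutes_not_in[OF rot_permutes[OF M]] permutes_not_in[OF opp_permutes[OF M]] by blast+
  then have "(\<lambda>x. if x \<notin> darts M then x else rot M x) = rot M"
    "(\<lambda>x. if x \<notin> darts M then x else opp M x) = opp M" by auto
  then show ?thesis by (simp add: contract_def cong: if_cong)
qed

lemma even_vertices_if_regular: "regular_map k M \<Longrightarrow> even k \<Longrightarrow> even_vertices M"
  by (simp add: regular_map_def even_vertices_def)


theorem theorem7:
  fixes n :: nat and P :: "'a cmap"
    and ps :: "(real \<Rightarrow> real^3) list" and lab :: "nat \<times> real \<Rightarrow> level" and L :: "(real^3) set"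
  assumes "n > 1"
    and "triple_crossing_map P" and "prime_map P" and "card (vertices P) = n"
    and "has_graph ps P"
    and "minimal_triple_crossing_diagram ps lab L"
    and "(is_knot L \<and> prime_link L) \<or> (tame_link L \<and> prime_link L \<and> \<not> split_link L)"
  shows "\<exists>S\<in>Sh (2 * n). \<exists>E\<subseteq>edges S.
           card E = n \<and> pairwise_vertex_disjoint S E \<and> equiv_mirror (contract S E) P"
proof -
  have sphere_P: "connected_sphere_map P" and reg_P: "regular_map 6 P"
    using assms(2) by (simp_all add: triple_crossing_map_def)
  then have P: "combinatorial_map P" by (simp add: connected_sphere_map_def)
  obtain f :: "'a \<Rightarrow> nat" where f: "inj_on f (darts P)"
    using finite_imp_inj_to_nat_seg[OF finite_darts[OF P]] by blast
  interpret relabelling P f by unfold_locales (fact P f)+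
  have sphere: "connected_sphere_map R" by (rule connected_sphere_map_R[OF sphere_P])
  have reg: "regular_map 6 R" by (rule regular_map_R[OF reg_P])
  have card_R: "card (vertices R) = n"
    using assms(4) by (simp add: vertices_R card_image_R subset_Pow_darts)
  have fc: "four_edge_connected R"
    using prime_imp_four_edge_connected[OF sphere even_vertices_if_regular[OF reg] prime_map_R[OF assms(3)]]
    by simp
  have all_six: "{v \<in> vertices R. card v = 6} = vertices R"
    using reg by (auto simp: regular_map_def)
  have "\<exists>S E. connected_sphere_map S \<and> four_edge_connected S \<and> regular_map 4 S \<and>
    card (vertices S) = card (vertices R) + n \<and> E \<subseteq> edges S \<and> card E = card ({} :: nat set set) + n \<and>
    pairwise_vertex_disjoint S E \<and> contract S E = contract R {}"
  proof (rule split_all_six_valent[OF sphere fc])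
    show "card v = 4 \<or> card v = 6" if "v \<in> vertices R" for v
      using reg that by (simp add: regular_map_def)
    show "1 < card (vertices R)" using assms(1) card_R by simp
    show "card {v \<in> vertices R. card v = 6} = n" using all_six card_R by simp
  qed (simp_all add: pairwise_vertex_disjoint_def)
  then obtain S E where S: "connected_sphere_map S" "four_edge_connected S" "regular_map 4 S"
      "card (vertices S) = 2 * n"
    and E: "E \<subseteq> edges S" "card E = n" "pairwise_vertex_disjoint S E"
    and c: "contract S E = R"
    using card_R contract_empty[OF combinatorial_map_R] by (metis card.empty add_0 mult_2)
  have cS: "combinatorial_map S" using S(1) by (simp add: connected_sphere_map_def)
  have "prime_map S"
    by (rule four_edge_connected_imp_prime[OF S(1,2)])
  moreover have "loopless S"
    using four_edge_connected_imp_loopless[OF cS S(2,3)] S(4) assms(1) by simp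
  ultimately have "S \<in> Sh (2 * n)" using S by (simp add: Sh_def)
  moreover have "equiv_mirror (contract S E) P"
    unfolding equiv_mirror_def c using cmap_iso_R by blast
  ultimately show ?thesis using E by blast
qed

end
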